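(* Let $S$ be a convex hypersurface of $\mathbb{R}^n$, and assume that $S$ is not of class $C^{1,1}_{\mathrm{loc}}$. Then the following assertions are equivalent: (1) For every $\varepsilon>0$ there exists a convex hypersurface $S_\varepsilon$ of $\mathbb{R}^n$ of class $C^{1,1}_{\mathrm{loc}}$ such that $\mathcal{H}^{n-1}(S\,\triangle\,S_\varepsilon)<\varepsilon$. (2) $S$ does not contain any line.
   Context: A convex hypersurface of $\mathbb{R}^n$ is the boundary $\partial W$ of a closed convex set $W\subset\mathbb{R}^n$ with nonempty interior (not necessarily bounded). It is of class $C^{1,1}_{\mathrm{loc}}$ if it is locally (in suitable Euclidean coordinates) the graph of a $C^{1,1}$ function, i.e. of a $C^1$ function with Lipschitz continuous derivative. A line is a set isometric to $\mathbb{R}$ (a full straight line; a half-line is not a line). $A\triangle B=(A\setminus B)\cup(B\setminus A)$, and $\mathcal{H}^{n-1}$ is the $(n-1)$-dimensional Hausdorff measure. *)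

theory Defs
  imports "HOL-Analysis.Analysis"
begin

definition convex_hypersurface :: "'a::euclidean_space set \<Rightarrow> bool" where
  "convex_hypersurface S \<longleftrightarrow>
     (\<exists>W. closed W \<and> convex W \<and> interior W \<noteq> {} \<and> S = frontier W)"

text \<open>
  \<open>f\<close> is \<open>C\<^sup>1\<close> with Lipschitz derivative on a relatively open subset \<open>D\<close> of a linear subspace \<open>V\<close>.
  Only the values of \<open>f\<close> on \<open>D\<close> and of \<open>Df y\<close> on \<open>V\<close> matter. The derivative within \<open>V\<close> does not
  determine \<open>Df y\<close> outside \<open>V\<close>, but extending by zero on the orthogonal complement preserves the
  operator norm, so the existential is equivalent to the Lipschitz condition for functionals on \<open>V\<close>.
\<close>

definition C11_on :: "'a::euclidean_space set \<Rightarrow> 'a set \<Rightarrow> ('a \<Rightarrow> real) \<Rightarrow> bool" where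
  "C11_on V D f \<longleftrightarrow>
     openin (top_of_set V) D \<and>
     (\<exists>(Df :: 'a \<Rightarrow> 'a \<Rightarrow>\<^sub>L real) L.
        (\<forall>y\<in>D. (f has_derivative blinfun_apply (Df y)) (at y within D)) \<and>
        L-lipschitz_on D Df)"

text \<open>
  A choice of Euclidean coordinates amounts to a unit vector \<open>v\<close> (the direction of the last axis)
  and the hyperplane \<open>{v}\<^sup>\<bottom>\<close> of the remaining coordinates; the point with coordinates
  \<open>(y, t)\<close> is \<open>y + t *\<^sub>R v\<close>. The choice of an orthonormal basis of \<open>{v}\<^sup>\<bottom>\<close> and of an origin
  does not affect regularity.
\<close>

definition C11_loc :: "'a::euclidean_space set \<Rightarrow> bool" where
  "C11_loc S \<longleftrightarrow>
     (\<forall>p\<in>S. \<exists>U v D f.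
        open U \<and> p \<in> U \<and> norm v = 1 \<and> C11_on ({v}\<^sup>\<bottom>) D f \<and>
        S \<inter> U = (\<lambda>y. y + f y *\<^sub>R v) ` D)"

definition is_line :: "'a::metric_space set \<Rightarrow> bool" where
  "is_line L \<longleftrightarrow>
     (\<exists>\<gamma> :: real \<Rightarrow> 'a. (\<forall>s t. dist (\<gamma> s) (\<gamma> t) = dist s t) \<and> L = range \<gamma>)"

text \<open>
  Hausdorff (outer) measure of integer dimension, normalised to agree with Lebesgue measure.
  Empty sets are counted as \<open>0\<close> explicitly because \<open>0 ^ 0 = 1\<close>, so that for \<open>m = 0\<close> one gets
  counting measure. Boundedness is required because \<^const>\<open>diameter\<close> is real-valued and thus
  meaningless on unbounded sets.
\<close>

definition hausdorff_premeasure :: "nat \<Rightarrow> real \<Rightarrow> 'a::metric_space set \<Rightarrow> ennreal" where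
  "hausdorff_premeasure m \<delta> A =
     (INF C \<in> {C :: nat \<Rightarrow> 'a set. A \<subseteq> (\<Union>i. C i) \<and> (\<forall>i. bounded (C i) \<and> diameter (C i) \<le> \<delta>)}.
        \<Sum>i. if C i = {} then 0 else ennreal (unit_ball_vol (real m) * (diameter (C i) / 2) ^ m))"

definition hausdorff_measure :: "nat \<Rightarrow> 'a::metric_space set \<Rightarrow> ennreal" where
  "hausdorff_measure m A = (SUP \<delta>\<in>{0<..}. hausdorff_premeasure m \<delta> A)"

end

theory Submission
  imports Defs
begin

text \<open>
  (2) implies (1). A line-free closed convex set \<open>W\<close> has a linear function \<open>h\<close>, bounded below
  on \<open>W\<close>, with compact sublevel slices. Let \<open>V\<close> be the union of all balls \<open>cball x r\<close> inside \<open>W\<close>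
  whose radius lies between a positive, convex, decreasing function of \<open>h x\<close> and 1. Then \<open>V\<close> is closed and
  convex, and at each frontier point it has an inner tangent ball of radius locally bounded away
  from zero, which makes its unit normal locally Lipschitz. The part of \<open>\<partial>W\<close> missed by \<open>\<partial>V\<close> is small because almost
  every point of \<open>\<partial>W\<close> is touched by an inner ball. The part of \<open>\<partial>V\<close> outside \<open>\<partial>W\<close> is no larger: it is
  contained in the image of \<open>\<partial>W - \<partial>V\<close> under the nearest-point projection onto \<open>V\<close>.

  For the existence of inner balls no second-order theory is needed. On a compact convex body with
  \<open>cball z c \<subseteq> W\<close>, the points touched by inner balls of radius \<open>r\<close> project onto the frontier of the
  inner parallel body, which in turn projects onto the frontier of the copy of \<open>W\<close> scaled by
  \<open>1 - r / c\<close>. Since projections do not increase Hausdorff measure, the touched points carry at least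
  the fraction \<open>(1 - r / c) ^ (n - 1)\<close> of the surface area.

  (1) implies (2). If \<open>\<partial>W\<close> contains a line of direction \<open>v\<close>, it is invariant under translation by \<open>v\<close>,
  and a frontier \<open>\<partial>V\<close> that misses only finite measure of it must meet arbitrarily far translates of
  each small piece of \<open>\<partial>W\<close>. Then \<open>V\<close> is itself invariant, and \<open>\<partial>W = \<partial>V\<close> follows.
\<close>

section \<open>Hausdorff measure as a metric outer measure\<close>

definition hausdorff_gauge :: "nat \<Rightarrow> 'a::metric_space set \<Rightarrow> ennreal" where
  "hausdorff_gauge m C =
     (if C = {} then 0 else ennreal (unit_ball_vol (real m) * (diameter C / 2) ^ m))"

definition fine_cover :: "real \<Rightarrow> 'a::metric_space set \<Rightarrow> (nat \<Rightarrow> 'a set) \<Rightarrow> bool" where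
  "fine_cover \<delta> A C \<longleftrightarrow> A \<subseteq> (\<Union>i. C i) \<and> (\<forall>i. bounded (C i) \<and> diameter (C i) \<le> \<delta>)"

lemma hausdorff_premeasure_alt:
  "hausdorff_premeasure m \<delta> A = (INF C \<in> {C. fine_cover \<delta> A C}. \<Sum>i. hausdorff_gauge m (C i))"
  by (simp add: hausdorff_premeasure_def hausdorff_gauge_def fine_cover_def)

lemma hausdorff_gauge_empty [simp]: "hausdorff_gauge m {} = 0"
  by (simp add: hausdorff_gauge_def)

lemma hausdorff_premeasure_le:
  "fine_cover \<delta> A C \<Longrightarrow> hausdorff_premeasure m \<delta> A \<le> (\<Sum>i. hausdorff_gauge m (C i))"
  unfolding hausdorff_premeasure_alt by (rule INF_lower) simp

lemma hausdorff_premeasure_approx: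
  assumes "hausdorff_premeasure m \<delta> A < c"
  obtains C where "fine_cover \<delta> A C" "(\<Sum>i. hausdorff_gauge m (C i)) < c"
  using assms unfolding hausdorff_premeasure_alt INF_less_iff by auto

lemma hausdorff_premeasure_mono:
  "A \<subseteq> B \<Longrightarrow> hausdorff_premeasure m \<delta> A \<le> hausdorff_premeasure m \<delta> B"
  unfolding hausdorff_premeasure_alt
  by (rule INF_superset_mono[OF _ order_refl]) (auto simp: fine_cover_def, blast)

lemma hausdorff_premeasure_antimono:
  "\<delta>' \<le> \<delta> \<Longrightarrow> hausdorff_premeasure m \<delta> A \<le> hausdorff_premeasure m \<delta>' A"
  unfolding hausdorff_premeasure_alt
  by (rule INF_superset_mono) (auto simp: fine_cover_def, meson order_trans)

lemma hausdorff_premeasure_le_measure: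
  "0 < \<delta> \<Longrightarrow> hausdorff_premeasure m \<delta> A \<le> hausdorff_measure m A"
  unfolding hausdorff_measure_def by (rule SUP_upper) simp

lemma hausdorff_measure_leI:
  "(\<And>\<delta>. 0 < \<delta> \<Longrightarrow> hausdorff_premeasure m \<delta> A \<le> c) \<Longrightarrow> hausdorff_measure m A \<le> c"
  unfolding hausdorff_measure_def by (rule SUP_least) simp

lemma hausdorff_measure_mono:
  "A \<subseteq> B \<Longrightarrow> hausdorff_measure m A \<le> hausdorff_measure m B"
  by (meson hausdorff_measure_leI hausdorff_premeasure_le_measure
      hausdorff_premeasure_mono order_trans)

lemma hausdorff_premeasure_gauge:
  assumes "bounded C" "diameter C \<le> \<delta>"
  shows "hausdorff_premeasure m \<delta> C \<le> hausdorff_gauge m C"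
proof -
  let ?D = "\<lambda>i::nat. if i = 0 then C else {}"
  have "0 \<le> \<delta>" using assms diameter_ge_0 order_trans by blast
  then have "fine_cover \<delta> C ?D" using assms by (auto simp: fine_cover_def)
  then have "hausdorff_premeasure m \<delta> C \<le> (\<Sum>i. hausdorff_gauge m (?D i))"
    by (rule hausdorff_premeasure_le)
  also have "\<dots> = hausdorff_gauge m C"
    using suminf_finite[of "{0::nat}" "\<lambda>i. hausdorff_gauge m (?D i)"] by simp
  finally show ?thesis .
qed

lemma hausdorff_premeasure_empty [simp]: "0 \<le> \<delta> \<Longrightarrow> hausdorff_premeasure m \<delta> {} = 0"
  using hausdorff_premeasure_gauge[of "{}" \<delta> m] by simp

lemma hausdorff_measure_empty [simp]: "hausdorff_measure m {} = 0"
 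
    by (metis hausdorff_measure_leI hausdorff_premeasure_empty le_zero_eq order_less_imp_le order_refl)

text \<open>Near-optimal covers of the sets \<open>A i\<close>, with errors
  \<open>e / 2 ^ (i + 1)\<close> that add up to \<open>e\<close>, are merged into a single sequence
  through \<open>prod_decode\<close>.\<close>

lemma hausdorff_premeasure_UN:
  fixes A :: "nat \<Rightarrow> 'a::metric_space set"
  shows "hausdorff_premeasure m \<delta> (\<Union>i. A i) \<le> (\<Sum>i. hausdorff_premeasure m \<delta> (A i))"
proof (rule ennreal_le_epsilon)
  fix e :: real
  assume fin: "(\<Sum>i. hausdorff_premeasure m \<delta> (A i)) < top" and e: "0 < e"
  have "\<exists>C. fine_cover \<delta> (A i) C \<and>
      (\<Sum>j. hausdorff_gauge m (C j)) \<le> hausdorff_premeasure m \<delta> (A i) + ennreal (e * (1/2) ^ Suc i)" for i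
  proof -
    have "hausdorff_premeasure m \<delta> (A i) < top"
      using fin by (metis ennreal_suminf_lessD less_top)
    then have "hausdorff_premeasure m \<delta> (A i) < hausdorff_premeasure m \<delta> (A i) + ennreal (e * (1/2) ^ Suc i)"
      using e by (simp add: ennreal_add_left_cancel_less less_top)
    then show ?thesis by (metis hausdorff_premeasure_approx less_imp_le)
  qed
  then obtain C where C: "\<And>i. fine_cover \<delta> (A i) (C i)"
    and Cs: "\<And>i. (\<Sum>j. hausdorff_gauge m (C i j)) \<le> hausdorff_premeasure m \<delta> (A i) + ennreal (e * (1/2) ^ Suc i)"
    by metis
  define D where "D n = (case prod_decode n of (i, j) \<Rightarrow> C i j)" for n
  have "fine_cover \<delta> (\<Union>i. A i) D"
    unfolding fine_cover_def
  proof (intro conjI allI)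
    show "(\<Union>i. A i) \<subseteq> (\<Union>n. D n)"
    proof
      fix x assume "x \<in> (\<Union>i. A i)"
      then obtain i j where "x \<in> C i j" using C unfolding fine_cover_def by blast
      then have "x \<in> D (prod_encode (i, j))" by (simp add: D_def)
      then show "x \<in> (\<Union>n. D n)" by blast
    qed
  qed (use C in \<open>auto simp: D_def fine_cover_def split: prod.split\<close>)
  then have "hausdorff_premeasure m \<delta> (\<Union>i. A i) \<le> (\<Sum>n. hausdorff_gauge m (D n))"
    by (rule hausdorff_premeasure_le)
  also have "\<dots> = (\<Sum>n. (\<lambda>(i, j). hausdorff_gauge m (C i j)) (prod_decode n))"
    by (intro suminf_cong) (simp add: D_def split: prod.split)
  also have "\<dots> = (\<Sum>i. \<Sum>j. hausdorff_gauge m (C i j))"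
    by (rule suminf_ennreal_2dimen) simp
  also have "\<dots> \<le> (\<Sum>i. hausdorff_premeasure m \<delta> (A i) + ennreal (e * (1/2) ^ Suc i))"
    by (intro suminf_le) (use Cs in auto)
  also have "\<dots> = (\<Sum>i. hausdorff_premeasure m \<delta> (A i)) + (\<Sum>i. ennreal (e * (1/2) ^ Suc i))"
    by (subst suminf_add) auto
  also have "(\<Sum>i. ennreal (e * (1/2) ^ Suc i)) = ennreal e"
  proof -
    have "(\<lambda>i. e * (1/2) ^ Suc i) sums (e * 1)"
      by (intro sums_mult power_half_series)
    then show ?thesis using e by (intro suminf_ennreal_eq) auto
  qed
  finally show "hausdorff_premeasure m \<delta> (\<Union>i. A i) \<le> (\<Sum>i. hausdorff_premeasure m \<delta> (A i)) + ennreal e" .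
qed

lemma hausdorff_measure_UN:
  fixes A :: "nat \<Rightarrow> 'a::metric_space set"
  shows "hausdorff_measure m (\<Union>i. A i) \<le> (\<Sum>i. hausdorff_measure m (A i))"
proof (rule hausdorff_measure_leI)
  fix \<delta> :: real assume "0 < \<delta>"
  then have "(\<Sum>i. hausdorff_premeasure m \<delta> (A i)) \<le> (\<Sum>i. hausdorff_measure m (A i))"
    by (intro suminf_le hausdorff_premeasure_le_measure) auto
  then show "hausdorff_premeasure m \<delta> (\<Union>i. A i) \<le> (\<Sum>i. hausdorff_measure m (A i))"
    using hausdorff_premeasure_UN order_trans by blast
qed

text \<open>The two sets are padded with empty sets to a sequence. The sign condition on \<delta>
  matters here: for negative \<delta> not even the empty set has a fine cover.\<close>

lemma hausdorff_premeasure_Un: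
  assumes "0 \<le> \<delta>"
  shows "hausdorff_premeasure m \<delta> (A \<union> B) \<le> hausdorff_premeasure m \<delta> A + hausdorff_premeasure m \<delta> B"
proof -
  let ?D = "\<lambda>i::nat. if i = 0 then A else if i = 1 then B else {}"
  have "(\<Union>i. ?D i) = A \<union> B" by (auto split: if_splits)
  moreover have "(\<Sum>i. hausdorff_premeasure m \<delta> (?D i)) = hausdorff_premeasure m \<delta> A + hausdorff_premeasure m \<delta> B"
    using suminf_finite[of "{0::nat, 1}" "\<lambda>i. hausdorff_premeasure m \<delta> (?D i)"] assms by simp
  ultimately show ?thesis using hausdorff_premeasure_UN[of m \<delta> ?D] by simp
qed

lemma hausdorff_measure_Un:
  "hausdorff_measure m (A \<union> B) \<le> hausdorff_measure m A + hausdorff_measure m B"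
proof (rule hausdorff_measure_leI)
  fix \<delta> :: real assume "0 < \<delta>"
  then show "hausdorff_premeasure m \<delta> (A \<union> B) \<le> hausdorff_measure m A + hausdorff_measure m B"
    using hausdorff_premeasure_Un[of \<delta> m A B]
    by (meson add_mono hausdorff_premeasure_le_measure less_imp_le order_trans)
qed

lemma hausdorff_premeasure_finite_UN:
  assumes "finite I" "0 \<le> \<delta>"
  shows "hausdorff_premeasure m \<delta> (\<Union>i\<in>I. A i) \<le> (\<Sum>i\<in>I. hausdorff_premeasure m \<delta> (A i))"
  using assms(1)
proof induction
  case (insert i I)
  have "hausdorff_premeasure m \<delta> (\<Union>j\<in>insert i I. A j)
      \<le> hausdorff_premeasure m \<delta> (A i) + hausdorff_premeasure m \<delta> (\<Union>j\<in>I. A j)"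
    using hausdorff_premeasure_Un[OF assms(2)] by simp
  also have "\<dots> \<le> hausdorff_premeasure m \<delta> (A i) + (\<Sum>j\<in>I. hausdorff_premeasure m \<delta> (A j))"
    using insert.IH add_left_mono by blast
  finally show ?case using insert.hyps by simp
qed (use assms in simp)

lemma hausdorff_measure_finite_UN:
  assumes "finite I"
  shows "hausdorff_measure m (\<Union>i\<in>I. A i) \<le> (\<Sum>i\<in>I. hausdorff_measure m (A i))"
  using assms
proof induction
  case (insert i I)
  have "hausdorff_measure m (\<Union>j\<in>insert i I. A j)
      \<le> hausdorff_measure m (A i) + hausdorff_measure m (\<Union>j\<in>I. A j)"
    using hausdorff_measure_Un by simp
  also have "\<dots> \<le> hausdorff_measure m (A i) + (\<Sum>j\<in>I. hausdorff_measure m (A j))"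
    using insert.IH add_left_mono by blast
  finally show ?case using insert.hyps by simp
qed simp

section \<open>Hausdorff measure under Lipschitz maps\<close>

lemma diameter_image_lipschitz:
  assumes "bounded C" "0 \<le> K" "\<And>x y. x \<in> C \<Longrightarrow> y \<in> C \<Longrightarrow> dist (f x) (f y) \<le> K * dist x y"
  shows "bounded (f ` C) \<and> diameter (f ` C) \<le> K * diameter C"
proof -
  have b: "dist (f x) (f y) \<le> K * diameter C" if "x \<in> C" "y \<in> C" for x y
    using assms that diameter_bounded_bound[OF assms(1) that]
    by (meson mult_left_mono order_trans)
  then have "bounded (f ` C)" by (auto simp: bounded_two_points)
  moreover have "diameter (f ` C) \<le> K * diameter C"
  proof (cases "C = {}")
    case False
    then have "(SUP (u, v)\<in>f ` C \<times> f ` C. dist u v) \<le> K * diameter C"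
      by (intro cSUP_least) (use b in auto)
    then show ?thesis using False by (simp add: diameter_def)
  qed simp
  ultimately show ?thesis by blast
qed

lemma hausdorff_gauge_lipschitz:
  assumes "bounded C" "0 \<le> K" "\<And>x y. x \<in> C \<Longrightarrow> y \<in> C \<Longrightarrow> dist (f x) (f y) \<le> K * dist x y"
  shows "hausdorff_gauge m (f ` C) \<le> ennreal (K ^ m) * hausdorff_gauge m C"
proof (cases "C = {}")
  case False
  have d: "bounded (f ` C)" "diameter (f ` C) \<le> K * diameter C"
    using diameter_image_lipschitz[OF assms] by auto
  have "(diameter (f ` C) / 2) ^ m \<le> (K * (diameter C / 2)) ^ m"
    using d diameter_ge_0[OF d(1)] by (intro power_mono) auto
  then have "unit_ball_vol (real m) * (diameter (f ` C) / 2) ^ m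
      \<le> K ^ m * (unit_ball_vol (real m) * (diameter C / 2) ^ m)"
    using mult_left_mono[of _ _ "unit_ball_vol (real m)"]
    by (simp add: power_mult_distrib mult_ac flip: times_divide_eq_right)
  then show ?thesis
    using False diameter_ge_0[OF assms(1)] assms(2)
    by (simp add: hausdorff_gauge_def ennreal_mult'[symmetric])
qed simp

text \<open>A cover of mesh \<open>\<delta> / K\<close> is pushed forward to a cover of mesh
  \<delta> whose gauges grow at most by the factor \<open>K ^ m\<close>.\<close>

lemma hausdorff_measure_lipschitz_image:
  assumes "0 < K" "\<And>x y. x \<in> A \<Longrightarrow> y \<in> A \<Longrightarrow> dist (f x) (f y) \<le> K * dist x y"
  shows "hausdorff_measure m (f ` A) \<le> ennreal (K ^ m) * hausdorff_measure m A"
proof (rule hausdorff_measure_leI)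
  fix \<delta> :: real assume d: "0 < \<delta>"
  have K0: "ennreal (K ^ m) \<noteq> 0" using assms(1) by simp
  have "hausdorff_premeasure m \<delta> (f ` A) \<le> ennreal (K ^ m) * hausdorff_premeasure m (\<delta> / K) A"
  proof -
    have "hausdorff_premeasure m \<delta> (f ` A) \<le> ennreal (K ^ m) * (\<Sum>i. hausdorff_gauge m (C i))"
      if C: "fine_cover (\<delta> / K) A C" for C
    proof -
      \<comment> \<open>The covering sets are first cut down to \<open>A\<close>, because
        \<open>f\<close> is controlled only there.\<close>
      have L: "bounded (f ` (C i \<inter> A)) \<and> diameter (f ` (C i \<inter> A)) \<le> \<delta>"
        "hausdorff_gauge m (f ` (C i \<inter> A)) \<le> ennreal (K ^ m) * hausdorff_gauge m (C i)" for i
      proof -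
        have b: "bounded (C i)" "diameter (C i) \<le> \<delta> / K"
          using C by (auto simp: fine_cover_def)
        have s: "bounded (C i \<inter> A)" "diameter (C i \<inter> A) \<le> diameter (C i)"
          using b diameter_subset[of "C i \<inter> A" "C i"] by (auto intro: bounded_subset)
        have "K * diameter (C i \<inter> A) \<le> \<delta>"
          using order_trans[OF mult_left_mono[OF s(2), of K], of \<delta>] b(2) assms(1)
          by (simp add: pos_le_divide_eq mult.commute)
        then show "bounded (f ` (C i \<inter> A)) \<and> diameter (f ` (C i \<inter> A)) \<le> \<delta>"
          using diameter_image_lipschitz[OF s(1), of K f] assms by fastforce
        have "hausdorff_gauge m (f ` (C i \<inter> A)) \<le> ennreal (K ^ m) * hausdorff_gauge m (C i \<inter> A)"
          using assms by (intro hausdorff_gauge_lipschitz s) auto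
        also have "hausdorff_gauge m (C i \<inter> A) \<le> hausdorff_gauge m (C i)"
          unfolding hausdorff_gauge_def
          using s(2) diameter_ge_0[OF s(1)] by (auto intro!: ennreal_leI mult_left_mono power_mono)
        finally show "hausdorff_gauge m (f ` (C i \<inter> A)) \<le> ennreal (K ^ m) * hausdorff_gauge m (C i)"
          by (simp add: mult_left_mono)
      qed
      have "fine_cover \<delta> (f ` A) (\<lambda>i. f ` (C i \<inter> A))"
        using C L(1) by (fastforce simp: fine_cover_def)
      then have "hausdorff_premeasure m \<delta> (f ` A) \<le> (\<Sum>i. hausdorff_gauge m (f ` (C i \<inter> A)))"
        by (rule hausdorff_premeasure_le)
      also have "\<dots> \<le> (\<Sum>i. ennreal (K ^ m) * hausdorff_gauge m (C i))"
        by (intro suminf_le L) auto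
      finally show ?thesis by simp
    qed
    \<comment> \<open>Moving the factor to the other side as \<open>(1 / K) ^ m\<close> leaves a
      bound that holds for each cover separately, so the infimum over covers can be taken.\<close>
    moreover have c: "ennreal ((1 / K) ^ m) * (ennreal (K ^ m) * x) = x"
      "ennreal (K ^ m) * (ennreal ((1 / K) ^ m) * x) = x" for x
      using assms(1)
        by (simp_all add: mult.assoc[symmetric] ennreal_mult'[symmetric] power_mult_distrib[symmetric])
    ultimately have "ennreal ((1 / K) ^ m) * hausdorff_premeasure m \<delta> (f ` A) \<le> (\<Sum>i. hausdorff_gauge m (C i))"
      if "fine_cover (\<delta> / K) A C" for C
      using that mult_left_mono[of _ _ "ennreal ((1 / K) ^ m)"] by (metis zero_le)
    then have "ennreal ((1 / K) ^ m) * hausdorff_premeasure m \<delta> (f ` A) \<le> hausdorff_premeasure m (\<delta> / K) A"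
      unfolding hausdorff_premeasure_alt[of m "\<delta> / K"] by (intro INF_greatest) auto
    then show ?thesis
      using mult_left_mono[of _ _ "ennreal (K ^ m)"] c(2) by (metis zero_le)
  qed
  also have "\<dots> \<le> ennreal (K ^ m) * hausdorff_measure m A"
    using d assms(1) by (intro mult_left_mono hausdorff_premeasure_le_measure) auto
  finally show "hausdorff_premeasure m \<delta> (f ` A) \<le> ennreal (K ^ m) * hausdorff_measure m A" .
qed

text \<open>In a cover of mesh below \<open>d\<close> no set meets both \<open>A\<close> and
  \<open>B\<close>, so the cover splits into one of \<open>A\<close> and one of
  \<open>B\<close>.\<close>

lemma hausdorff_measure_separated:
  assumes "0 < d" "\<And>x y. x \<in> A \<Longrightarrow> y \<in> B \<Longrightarrow> d \<le> dist x y"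
  shows "hausdorff_measure m A + hausdorff_measure m B \<le> hausdorff_measure m (A \<union> B)"
proof -
  have main: "hausdorff_premeasure m \<delta> A + hausdorff_premeasure m \<delta> B \<le> hausdorff_measure m (A \<union> B)"
    if d: "0 < \<delta>" "\<delta> < d" for \<delta>
  proof -
    have "hausdorff_premeasure m \<delta> A + hausdorff_premeasure m \<delta> B \<le> (\<Sum>i. hausdorff_gauge m (C i))"
      if C: "fine_cover \<delta> (A \<union> B) C" for C
    proof -
      let ?P = "\<lambda>X i. if C i \<inter> X = {} then {} else C i"
      have cov: "fine_cover \<delta> A (?P A)" "fine_cover \<delta> B (?P B)"
        using C d by (auto simp: fine_cover_def subset_iff) (metis disjoint_iff)+
      have "hausdorff_premeasure m \<delta> A + hausdorff_premeasure m \<delta> B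
          \<le> (\<Sum>i. hausdorff_gauge m (?P A i)) + (\<Sum>i. hausdorff_gauge m (?P B i))"
        by (intro add_mono hausdorff_premeasure_le cov)
      also have "\<dots> = (\<Sum>i. hausdorff_gauge m (?P A i) + hausdorff_gauge m (?P B i))"
        by (rule suminf_add) auto
      also have "\<dots> \<le> (\<Sum>i. hausdorff_gauge m (C i))"
      proof (intro suminf_le)
        fix i
        have "C i \<inter> A = {} \<or> C i \<inter> B = {}"
        proof (rule ccontr)
          assume "\<not> ?thesis"
          then obtain x y where xy: "x \<in> C i" "x \<in> A" "y \<in> C i" "y \<in> B" by blast
          have "dist x y \<le> \<delta>"
            using C xy diameter_bounded_bound[of "C i" x y] unfolding fine_cover_def
            by (meson order_trans)
          then show False using assms(2)[OF xy(2,4)] d by linarith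
        qed
        then show "hausdorff_gauge m (?P A i) + hausdorff_gauge m (?P B i) \<le> hausdorff_gauge m (C i)"
          by auto
      qed auto
      finally show ?thesis .
    qed
    then have "hausdorff_premeasure m \<delta> A + hausdorff_premeasure m \<delta> B \<le> hausdorff_premeasure m \<delta> (A \<union> B)"
      unfolding hausdorff_premeasure_alt[of m \<delta> "A \<union> B"] by (intro INF_greatest) auto
    then show ?thesis using hausdorff_premeasure_le_measure[OF d(1)] order_trans by blast
  qed
  \<comment> \<open>Two independent mesh sizes are allowed so that the two suprema can be taken one
    after the other.\<close>
  have "hausdorff_premeasure m \<delta> A + hausdorff_premeasure m \<delta>' B \<le> hausdorff_measure m (A \<union> B)"
    if "0 < \<delta>" "0 < \<delta>'" for \<delta> \<delta>'
  proof -
    define \<eta> where "\<eta> = min (d / 2) (min \<delta> \<delta>')"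
    have "0 < \<eta>" "\<eta> < d" "\<eta> \<le> \<delta>" "\<eta> \<le> \<delta>'" using that assms(1) by (auto simp: \<eta>_def)
    then show ?thesis
      using main[of \<eta>] hausdorff_premeasure_antimono by (meson add_mono order_trans)
  qed
  then have "(SUP \<delta>\<in>{0<..}. hausdorff_premeasure m \<delta> A) + hausdorff_premeasure m \<delta>' B
      \<le> hausdorff_measure m (A \<union> B)" if "0 < \<delta>'" for \<delta>'
    using that by (subst ennreal_SUP_add_left[symmetric]) (auto intro!: SUP_least)
  then show ?thesis
    unfolding hausdorff_measure_def[of m A] hausdorff_measure_def[of m B]
    by (subst ennreal_SUP_add_right) (auto intro!: SUP_least)
qed

text \<open>Caratheodory's argument: the rings \<open>R j\<close> around \<open>F\<close> with indices of equal parity are separated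
  from each other, so their measures have a finite sum and the tail of the sum is negligible.\<close>

lemma hausdorff_measure_Int_Diff_closed:
  fixes F :: "'a::metric_space set"
  assumes "closed F"
  shows "hausdorff_measure m (A \<inter> F) + hausdorff_measure m (A - F) \<le> hausdorff_measure m A"
proof (cases "F = {} \<or> hausdorff_measure m A = top")
  case True
  then show ?thesis by auto
next
  case False
  let ?H = "hausdorff_measure m"
  define B where "B j = {x \<in> A. 1 / real (Suc j) \<le> infdist x F}" for j
  define R where "R j = B (Suc j) - B j" for j
  have lip: "infdist x F \<le> infdist y F + dist x y" for x y
    using infdist_triangle by fastforce
  have BF: "?H (A \<inter> F) + ?H (B j) \<le> ?H A" for j
  proof -
    have "?H (A \<inter> F) + ?H (B j) \<le> ?H ((A \<inter> F) \<union> B j)"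
    proof (rule hausdorff_measure_separated)
      show "1 / real (Suc j) \<le> dist x y" if "x \<in> A \<inter> F" "y \<in> B j" for x y
        using that lip[of y x] by (auto simp: B_def dist_commute)
    qed simp
    also have "\<dots> \<le> ?H A" by (rule hausdorff_measure_mono) (auto simp: B_def)
    finally show ?thesis .
  qed
  \<comment> \<open>The bound is positive once at least one ring is skipped
    (\<open>k > j + 1\<close>) and vanishes for adjacent rings; hence the split by parity.\<close>
  have sep: "1 / real (Suc (Suc j)) - 1 / real (Suc k) \<le> dist x y"
    if "x \<in> B (Suc j)" "y \<in> R k" for x y j k
    using that lip[of x y] by (auto simp: B_def R_def)
  have odd_even: "(\<Sum>j<N. ?H (R (2 * j + e))) \<le> ?H (\<Union>j<N. R (2 * j + e))" for N e
  proof (induction N)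
    case (Suc N)
    have "?H (\<Union>j<N. R (2 * j + e)) + ?H (R (2 * N + e))
        \<le> ?H ((\<Union>j<N. R (2 * j + e)) \<union> R (2 * N + e))"
    proof (cases N)
      case (Suc M)
      have sub: "R (2 * j + e) \<subseteq> B (Suc (2 * M + e))" if "j < N" for j
      proof -
        have "1 / real (Suc (Suc (2 * M + e))) \<le> 1 / real (Suc (Suc (2 * j + e)))"
          using that Suc by (intro divide_left_mono) auto
        then show ?thesis by (auto simp: R_def B_def)
      qed
      have "(0::real) < 1 / real (Suc (Suc (2 * M + e))) - 1 / real (Suc (2 * N + e))"
        using Suc by (auto simp: divide_strict_left_mono)
      then show ?thesis
        by (rule hausdorff_measure_separated) (meson UN_E lessThan_iff sep sub subsetD)
    qed simp
    also have "(\<Union>j<N. R (2 * j + e)) \<union> R (2 * N + e) = (\<Union>j<Suc N. R (2 * j + e))"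
      by (auto simp: less_Suc_eq)
    finally show ?case using Suc.IH by (simp add: add.commute) (meson add_left_mono order_trans)
  qed simp
  have fin: "(\<Sum>j. ?H (R j)) < top"
  proof -
    have "(\<Sum>j<N. ?H (R j)) \<le> 2 * ?H A" for N
    proof -
      have "(\<Sum>j<N. ?H (R j)) \<le> (\<Sum>j<2 * N. ?H (R j))"
        by (intro sum_mono2) auto
      also have "\<dots> = (\<Sum>j<N. ?H (R (2 * j + 0))) + (\<Sum>j<N. ?H (R (2 * j + 1)))"
        by (induction N) (auto simp: add_ac)
      also have "\<dots> \<le> ?H A + ?H A"
        by (intro add_mono order_trans[OF odd_even] hausdorff_measure_mono) (auto simp: R_def B_def)
      finally show ?thesis by (simp add: mult_2)
    qed
    then have "(\<Sum>j. ?H (R j)) \<le> 2 * ?H A" by (intro suminf_le_const) auto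
    also have "\<dots> < top" using False by (simp add: ennreal_mult_less_top less_top)
    finally show ?thesis .
  qed
  \<comment> \<open>Since \<open>F\<close> is closed, a point outside it has positive distance and
    lies in some \<open>B k\<close>. The least such index puts it either into \<open>B j\<close> or
    into a later ring.\<close>
  have AF: "A - F \<subseteq> B j \<union> (\<Union>k. R (k + j))" for j
  proof
    fix x assume x: "x \<in> A - F"
    then have "infdist x F > 0"
      using assms False by (metis DiffD2 in_closed_iff_infdist_zero infdist_nonneg less_eq_real_def)
    then obtain k where "1 / real (Suc k) < infdist x F"
      by (metis inverse_eq_divide reals_Archimedean)
    then have ex: "x \<in> B k" using x by (auto simp: B_def)
    define k0 where "k0 = (LEAST k. x \<in> B k)"
    have k0: "x \<in> B k0" "\<And>i. i < k0 \<Longrightarrow> x \<notin> B i"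
      unfolding k0_def using ex LeastI not_less_Least by metis+
    show "x \<in> B j \<union> (\<Union>k. R (k + j))"
    proof (cases "k0 \<le> j")
      case True
      then have "1 / real (Suc j) \<le> 1 / real (Suc k0)" by (intro divide_left_mono) auto
      then show ?thesis using k0 by (auto simp: B_def)
    next
      case False
      then obtain i where "k0 = Suc (i + j)"
        by (metis add.commute less_iff_Suc_add not_le)
      then show ?thesis using k0 by (auto simp: R_def)
    qed
  qed
  let ?s = "\<Sum>j. ?H (R j)"
  \<comment> \<open>Adding the first \<open>j\<close> rings to both sides completes the tail to the
    full sum \<open>?s\<close>. Being finite, \<open>?s\<close> can be cancelled at the end, so no
    subtraction of extended values occurs.\<close>
  have "(?H (A \<inter> F) + ?H (A - F)) + (\<Sum>k<j. ?H (R k)) \<le> ?H A + ?s" for j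
  proof -
    have "?H (A - F) \<le> ?H (B j) + ?H (\<Union>k. R (k + j))"
      using AF hausdorff_measure_mono hausdorff_measure_Un order_trans by metis
    also have "\<dots> \<le> ?H (B j) + (\<Sum>k. ?H (R (k + j)))"
      by (intro add_left_mono hausdorff_measure_UN)
    finally have "?H (A \<inter> F) + ?H (A - F) \<le> ?H (A \<inter> F) + (?H (B j) + (\<Sum>k. ?H (R (k + j))))"
      by (rule add_left_mono)
    also have "\<dots> \<le> ?H A + (\<Sum>k. ?H (R (k + j)))"
      using add_right_mono[OF BF] by (simp add: add.assoc)
    finally have "(?H (A \<inter> F) + ?H (A - F)) + (\<Sum>k<j. ?H (R k))
        \<le> ?H A + (\<Sum>k. ?H (R (k + j))) + (\<Sum>k<j. ?H (R k))"
      by (rule add_right_mono)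
    also have "\<dots> = ?H A + ?s"
      using suminf_offset[of "\<lambda>k. ?H (R k)" j] by (simp add: add_ac)
    finally show ?thesis .
  qed
  then have "(?H (A \<inter> F) + ?H (A - F)) + ?s \<le> ?H A + ?s"
    unfolding suminf_eq_SUP[of "\<lambda>j. ?H (R j)"] by (subst ennreal_SUP_add_right) (auto intro!: SUP_least)
  then show ?thesis using fin by (auto simp add: ennreal_add_left_cancel_le add.commute)
qed

section \<open>Nearest-point projections between convex frontiers\<close>

text \<open>The functional of the supporting hyperplane attains its minimum at \<open>y\<close>; its
  negative, normalised, is an outer unit normal.\<close>

lemma supporting_unit_normal:
  fixes V :: "'a::euclidean_space set"
  assumes "convex V" "interior V \<noteq> {}" "y \<in> frontier V"
  obtains u where "norm u = 1" "\<And>z. z \<in> V \<Longrightarrow> u \<bullet> (z - y) \<le> 0"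
proof -
  have "y \<in> closure V" "y \<notin> rel_interior V"
    using assms rel_interior_nonempty_interior[of V] by (auto simp: frontier_def)
  then obtain a where a: "a \<noteq> 0" "\<And>z. z \<in> closure V \<Longrightarrow> a \<bullet> y \<le> a \<bullet> z"
    using supporting_hyperplane_relative_frontier[OF assms(1)] by metis
  show ?thesis
  proof
    show "norm (- (a /\<^sub>R norm a)) = 1" using a(1) by simp
    show "- (a /\<^sub>R norm a) \<bullet> (z - y) \<le> 0" if "z \<in> V" for z
      using a that closure_subset[of V] by (auto simp: inner_diff_right divide_simps)
  qed
qed

text \<open>The vector \<open>z - y\<close> never makes an acute angle with \<open>u\<close>, so
  subtracting it from \<open>s *\<^sub>R u\<close> cannot shorten that vector.\<close>

lemma closest_point_along_normal:
  fixes V :: "'a::euclidean_space set"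
  assumes "convex V" "closed V" "y \<in> V" "\<And>z. z \<in> V \<Longrightarrow> u \<bullet> (z - y) \<le> 0" "0 \<le> s"
  shows "closest_point V (y + s *\<^sub>R u) = y"
proof -
  have "dist (y + s *\<^sub>R u) y \<le> dist (y + s *\<^sub>R u) z" if "z \<in> V" for z
  proof -
    have "s *\<^sub>R u \<bullet> (z - y) \<le> 0"
      using assms(4)[OF that] assms(5) by (simp add: mult_nonneg_nonpos)
    then have "norm (s *\<^sub>R u) ^ 2 \<le> norm (s *\<^sub>R u - (z - y)) ^ 2"
      unfolding power2_norm_eq_inner using inner_ge_zero[of "z - y"]
      by (simp add: inner_diff inner_commute algebra_simps)
    then have "norm (s *\<^sub>R u) \<le> norm (s *\<^sub>R u - (z - y))"
      by (rule power2_le_imp_le) simp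
    then show ?thesis by (simp add: dist_norm algebra_simps)
  qed
  then show ?thesis using closest_point_unique[OF assms(1-3)] by metis
qed

text \<open>Walking from \<open>y\<close> along an outer normal of \<open>V\<close> until
  \<open>W\<close> is left, one crosses the frontier of \<open>W\<close> at a point that projects
  back to \<open>y\<close>. The assumption \<open>exit\<close> takes the place of compactness, so
  that unbounded \<open>W\<close> are covered as well.\<close>

lemma frontier_exit_point:
  fixes V :: "'a::euclidean_space set"
  assumes V: "convex V" "closed V" "interior V \<noteq> {}" and y: "y \<in> frontier V"
    and W: "closed W" "V \<subseteq> W"
    and exit: "\<And>u. norm u = 1 \<Longrightarrow> (\<And>z. z \<in> V \<Longrightarrow> u \<bullet> (z - y) \<le> 0) \<Longrightarrow> \<exists>s\<ge>0. y + s *\<^sub>R u \<notin> W"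
  obtains x where "x \<in> frontier W" "closest_point V x = y"
proof -
  obtain u where u: "norm u = 1" "\<And>z. z \<in> V \<Longrightarrow> u \<bullet> (z - y) \<le> 0"
    using supporting_unit_normal[OF V(1,3) y] by blast
  obtain s where s: "0 \<le> s" "y + s *\<^sub>R u \<notin> W" using exit[OF u] by blast
  have yV: "y \<in> V" using y V(2) frontier_subset_closed by blast
  have "closed_segment y (y + s *\<^sub>R u) \<inter> frontier W \<noteq> {}"
    using yV W(2) s(2) by (intro connected_Int_frontier) auto
  then obtain x where x: "x \<in> closed_segment y (y + s *\<^sub>R u)" "x \<in> frontier W" by blast
  obtain t where t: "0 \<le> t" "x = y + (t * s) *\<^sub>R u"
    using x(1) by (auto simp: in_segment algebra_simps)
  show ?thesis
    using that[OF x(2)] closest_point_along_normal[OF V(1,2) yV u(2), of "t * s"] t s by simp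
qed

lemma frontier_exit_point_bounded:
  fixes V :: "'a::euclidean_space set"
  assumes "convex V" "closed V" "interior V \<noteq> {}" "y \<in> frontier V" "compact W" "V \<subseteq> W"
  obtains x where "x \<in> frontier W" "closest_point V x = y"
proof (rule frontier_exit_point[OF assms(1-4) compact_imp_closed[OF assms(5)] assms(6)])
  fix u :: 'a assume u: "norm u = 1"
  obtain B where B: "\<And>x. x \<in> W \<Longrightarrow> norm x \<le> B"
    using compact_imp_bounded[OF assms(5)] by (auto simp: bounded_iff)
  let ?s = "\<bar>B\<bar> + norm y + 1"
  have "norm (?s *\<^sub>R u) \<le> norm (y + ?s *\<^sub>R u) + norm y"
    by (metis add_diff_cancel_left' norm_triangle_ineq4)
  then have "y + ?s *\<^sub>R u \<notin> W" using B[of "y + ?s *\<^sub>R u"] u by auto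
  then show "\<exists>s\<ge>0. y + s *\<^sub>R u \<notin> W"
    by (metis abs_ge_zero add_nonneg_nonneg norm_ge_zero zero_le_one)
qed (use that in blast)

text \<open>The nearest-point projection onto \<open>V\<close> is 1-Lipschitz and maps the frontier
  of \<open>W\<close> over that of \<open>V\<close>.\<close>

lemma hausdorff_measure_frontier_mono:
  fixes V :: "'a::euclidean_space set"
  assumes "convex V" "closed V" "interior V \<noteq> {}" "compact W" "V \<subseteq> W"
  shows "hausdorff_measure m (frontier V) \<le> hausdorff_measure m (frontier W)"
proof -
  have "frontier V \<subseteq> closest_point V ` frontier W"
    using frontier_exit_point_bounded[OF assms(1-3) _ assms(4,5)] by (metis image_eqI subsetI)
  then have "hausdorff_measure m (frontier V) \<le> hausdorff_measure m (closest_point V ` frontier W)"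
    by (rule hausdorff_measure_mono)
  also have "\<dots> \<le> ennreal (1 ^ m) * hausdorff_measure m (frontier W)"
    using assms by (intro hausdorff_measure_lipschitz_image) (auto intro!: closest_point_lipschitz)
  finally show ?thesis by simp
qed

text \<open>The face is cut into \<open>N ^ (n - 1)\<close> cells of side \<open>2 * R / N\<close>.
  Their diameters are bounded crudely through the l1 norm, and the powers of \<open>N\<close> cancel
  in the sum, which leaves the bound \<open>?K\<close> independent of the mesh.\<close>

lemma hausdorff_measure_cube_face:
  fixes b :: "'a::euclidean_space"
  assumes b: "b \<in> Basis" and R: "0 < R"
  shows "hausdorff_measure (DIM('a) - 1) {x. x \<bullet> b = c \<and> (\<forall>i\<in>Basis. \<bar>x \<bullet> i\<bar> \<le> R)} < top"
proof -
  let ?m = "DIM('a) - 1" and ?n = "real DIM('a)"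
  let ?F = "{x. x \<bullet> b = c \<and> (\<forall>i\<in>Basis. \<bar>x \<bullet> i\<bar> \<le> R)}"
  let ?K = "ennreal (unit_ball_vol (real ?m) * (?n * R) ^ ?m)"
  have "hausdorff_premeasure ?m \<delta> ?F \<le> ?K" if \<delta>: "0 < \<delta>" for \<delta>
  proof -
    obtain N where N: "?n * (2 * R) / \<delta> < real N" using reals_Archimedean2 by blast
    have "0 < ?n * (2 * R) / \<delta>" using R \<delta> by simp
    then have N0: "0 < N" using N by (metis less_trans of_nat_0_less_iff)
    define I where "I = (Basis - {b}) \<rightarrow>\<^sub>E {..<N}"
    define P where "P f = {x. x \<bullet> b = c \<and> (\<forall>i\<in>Basis - {b}.
        2 * R * real (f i) / N \<le> x \<bullet> i + R \<and> x \<bullet> i + R \<le> 2 * R * (real (f i) + 1) / N)}" for f :: "'a \<Rightarrow> nat"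
    have finI: "finite I" unfolding I_def by (intro finite_PiE) auto
    have cardI: "card I = N ^ ?m" using b by (simp add: I_def card_PiE)
    have nrm: "norm (x - y) \<le> ?n * (2 * R / N)" if "x \<in> P f" "y \<in> P f" for f x y
    proof -
      have "\<bar>(x - y) \<bullet> i\<bar> \<le> 2 * R / N" if i: "i \<in> Basis" for i
      proof (cases "i = b")
        case False
        then have "2 * R * real (f i) / N \<le> x \<bullet> i + R" "x \<bullet> i + R \<le> 2 * R * (real (f i) + 1) / N"
          "2 * R * real (f i) / N \<le> y \<bullet> i + R" "y \<bullet> i + R \<le> 2 * R * (real (f i) + 1) / N"
          using \<open>x \<in> P f\<close> \<open>y \<in> P f\<close> i by (auto simp: P_def)
        then show ?thesis
          by (auto simp: inner_diff_left ring_distribs add_divide_distrib)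
      qed (use \<open>x \<in> P f\<close> \<open>y \<in> P f\<close> R in \<open>auto simp: P_def inner_diff_left\<close>)
      then have "(\<Sum>i\<in>Basis. \<bar>(x - y) \<bullet> i\<bar>) \<le> (\<Sum>i\<in>(Basis::'a set). 2 * R / N)"
        by (rule sum_mono)
      then show ?thesis using norm_le_l1[of "x - y"] by simp
    qed
    have bd: "bounded (P f)" for f
      unfolding bounded_two_points using nrm by (auto simp: dist_norm)
    have dm: "diameter (P f) \<le> ?n * (2 * R / N)" for f
      using nrm R by (intro diameter_le) auto
    have N\<delta>: "?n * (2 * R / N) \<le> \<delta>" using N \<delta> N0 by (simp add: field_simps)
    have "?F \<subseteq> (\<Union>f\<in>I. P f)"
    proof
      fix x assume x: "x \<in> ?F"
      have "\<exists>k<N. 2 * R * real k / N \<le> x \<bullet> i + R \<and> x \<bullet> i + R \<le> 2 * R * (real k + 1) / N"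
        if i: "i \<in> Basis" for i
      proof -
        define s where "s = (x \<bullet> i + R) * N / (2 * R)"
        have "\<bar>x \<bullet> i\<bar> \<le> R" using x i by auto
        then have s0: "0 \<le> s" and sN: "(x \<bullet> i + R) * N \<le> 2 * R * N"
          using R by (auto simp: s_def intro!: mult_right_mono)
        have sN: "s \<le> N" using sN R by (simp add: s_def pos_divide_le_eq mult.commute)
        \<comment> \<open>The minimum assigns the end value \<open>s = N\<close> to the last
          cell.\<close>
        define k where "k = min (N - 1) (nat \<lfloor>s\<rfloor>)"
        have "k < N" "real k \<le> s" "s \<le> real k + 1"
          using N0 s0 sN unfolding k_def by linarith+
        moreover have "x \<bullet> i + R = 2 * R * s / N"
          using R N0 by (simp add: s_def)
        ultimately show ?thesis
          using R N0
            by (metis divide_right_mono mult_left_mono of_nat_0_le_iff less_imp_le mult_pos_pos zero_less_numeral)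
      qed
      then obtain f where f: "\<And>i. i \<in> Basis \<Longrightarrow> f i < N \<and> 2 * R * real (f i) / N \<le> x \<bullet> i + R \<and> x \<bullet> i + R \<le> 2 * R * (real (f i) + 1) / N"
        by metis
      have "x \<in> P (restrict f (Basis - {b}))" "restrict f (Basis - {b}) \<in> I"
        using f x by (auto simp: P_def I_def)
      then show "x \<in> (\<Union>f\<in>I. P f)" by blast
    qed
    then have "hausdorff_premeasure ?m \<delta> ?F \<le> hausdorff_premeasure ?m \<delta> (\<Union>f\<in>I. P f)"
      by (rule hausdorff_premeasure_mono)
    also have "\<dots> \<le> (\<Sum>f\<in>I. hausdorff_premeasure ?m \<delta> (P f))"
      using finI \<delta> by (intro hausdorff_premeasure_finite_UN) auto
    also have "\<dots> \<le> (\<Sum>f\<in>I. ennreal (unit_ball_vol (real ?m) * (?n * R / N) ^ ?m))"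
    proof (rule sum_mono)
      fix f assume "f \<in> I"
      have "hausdorff_premeasure ?m \<delta> (P f) \<le> hausdorff_gauge ?m (P f)"
        using bd dm N\<delta> by (intro hausdorff_premeasure_gauge) (auto intro: order_trans)
      also have "\<dots> \<le> ennreal (unit_ball_vol (real ?m) * (?n * R / N) ^ ?m)"
        unfolding hausdorff_gauge_def using dm[of f] diameter_ge_0[OF bd[of f]]
        by (auto intro!: ennreal_leI mult_left_mono power_mono simp: mult_ac)
      finally show "hausdorff_premeasure ?m \<delta> (P f) \<le> ennreal (unit_ball_vol (real ?m) * (?n * R / N) ^ ?m)" .
    qed
    also have "\<dots> = ?K"
      using N0 R
        by (simp add: cardI ennreal_of_nat_eq_real_of_nat ennreal_mult'[symmetric] power_divide flip: of_nat_power)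
    finally show ?thesis .
  qed
  then have "hausdorff_measure ?m ?F \<le> ?K" by (rule hausdorff_measure_leI)
  then show ?thesis by (simp add: le_less_trans)
qed

text \<open>Comparison with an enclosing cube, whose frontier consists of finitely many
  faces.\<close>

lemma hausdorff_measure_frontier_finite:
  fixes W :: "'a::euclidean_space set"
  assumes "convex W" "compact W" "interior W \<noteq> {}"
  shows "hausdorff_measure (DIM('a) - 1) (frontier W) < top"
proof -
  let ?m = "DIM('a) - 1"
  obtain B where B: "\<And>x. x \<in> W \<Longrightarrow> norm x \<le> B" "0 < B"
    using compact_imp_bounded[OF assms(2)] by (auto simp: bounded_pos)
  let ?Q = "cbox (- B *\<^sub>R One) (B *\<^sub>R One) :: 'a set"
  let ?F = "\<lambda>b c. {x::'a. x \<bullet> b = c \<and> (\<forall>i\<in>Basis. \<bar>x \<bullet> i\<bar> \<le> B)}"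
  have "W \<subseteq> ?Q"
    using B Basis_le_norm order_trans by (fastforce simp: mem_box)
  then have "hausdorff_measure ?m (frontier W) \<le> hausdorff_measure ?m (frontier ?Q)"
    using assms by (intro hausdorff_measure_frontier_mono) (auto simp: compact_imp_closed)
  also have "\<dots> \<le> hausdorff_measure ?m (\<Union>(b, c)\<in>Basis \<times> {- B, B}. ?F b c)"
  proof (rule hausdorff_measure_mono, rule subsetI)
    fix x assume "x \<in> frontier ?Q"
    then have x: "x \<in> ?Q" "x \<notin> box (- B *\<^sub>R One) (B *\<^sub>R One)"
      by (auto simp: frontier_cbox)
    then obtain b where b: "b \<in> Basis" "x \<bullet> b \<le> - B \<or> B \<le> x \<bullet> b"
      by (auto simp: mem_box not_less)
    have le: "\<bar>x \<bullet> i\<bar> \<le> B" if "i \<in> Basis" for i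
      using x(1) that by (auto simp: mem_box)
    then have "x \<bullet> b = - B \<or> x \<bullet> b = B" using b by fastforce
    then show "x \<in> (\<Union>(b, c)\<in>Basis \<times> {- B, B}. ?F b c)" using b(1) le by blast
  qed
  also have "\<dots> \<le> (\<Sum>(b, c)\<in>Basis \<times> {- B, B}. hausdorff_measure ?m (?F b c))"
    using hausdorff_measure_finite_UN[of "Basis \<times> {- B, B}" ?m "\<lambda>(b, c). ?F b c"]
    by (simp add: case_prod_unfold)
  also have "\<dots> < top"
    using hausdorff_measure_cube_face[OF _ B(2)] by (auto simp: less_top)
  finally show ?thesis .
qed

section \<open>Points touched by inner balls\<close>

definition inner_ball_points :: "real \<Rightarrow> 'a::euclidean_space set \<Rightarrow> 'a set" where
  "inner_ball_points r W = {p \<in> frontier W. \<exists>x. p \<in> cball x r \<and> cball x r \<subseteq> W}"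

text \<open>The inner parallel body is an intersection of translates of \<open>W\<close>, one for
  each vector of \<open>cball 0 r\<close>.\<close>

lemma closed_inner_parallel:
  fixes W :: "'a::euclidean_space set"
  assumes "closed W"
  shows "closed {x. cball x r \<subseteq> W}"
proof -
  have "{x. cball x r \<subseteq> W} = (\<Inter>b\<in>cball 0 r. (\<lambda>x. b + x) -` W)"
  proof (intro set_eqI iffI)
    fix x assume "x \<in> {x. cball x r \<subseteq> W}"
    moreover have "b + x \<in> cball x r" if "b \<in> cball 0 r" for b
      using that by (simp add: dist_norm)
    ultimately show "x \<in> (\<Inter>b\<in>cball 0 r. (\<lambda>x. b + x) -` W)" by blast
  next
    fix x assume x: "x \<in> (\<Inter>b\<in>cball 0 r. (\<lambda>x. b + x) -` W)"
    have "z \<in> W" if "z \<in> cball x r" for z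
    proof -
      have "z - x \<in> cball 0 r" using that by (simp add: dist_norm norm_minus_commute)
      from INT_D[OF x this] have "(z - x) + x \<in> W" by (rule vimageD)
      then show ?thesis by simp
    qed
    then show "x \<in> {x. cball x r \<subseteq> W}" by blast
  qed
  moreover have "closed ((\<lambda>x. b + x) -` W)" for b
    using assms by (intro closed_vimage continuous_intros)
  ultimately show ?thesis by (metis (no_types, lifting) closed_INT)
qed

text \<open>The offset of \<open>z\<close> from the combined centre is \<open>u * r + v * s\<close>
  times a vector \<open>d\<close> of norm at most 1. The same \<open>d\<close>, scaled by
  \<open>r\<close> and by \<open>s\<close>, gives the two points.\<close>

lemma convex_combination_cball:
  fixes x y :: "'a::real_normed_vector"
  assumes "0 \<le> u" "0 \<le> v" "0 \<le> r" "0 \<le> s" "z \<in> cball (u *\<^sub>R x + v *\<^sub>R y) (u * r + v * s)"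
  obtains p q where "p \<in> cball x r" "q \<in> cball y s" "z = u *\<^sub>R p + v *\<^sub>R q"
proof (cases "u * r + v * s = 0")
  case True
  then show ?thesis using assms that[of x y] by simp
next
  case False
  define d where "d = (1 / (u * r + v * s)) *\<^sub>R (z - (u *\<^sub>R x + v *\<^sub>R y))"
  have pos: "0 < u * r + v * s" using False assms by (simp add: add_nonneg_nonneg order_less_le)
  then have "norm d \<le> 1"
    using assms(5) by (simp add: d_def dist_norm norm_minus_commute)
  then have "x + r *\<^sub>R d \<in> cball x r" "y + s *\<^sub>R d \<in> cball y s"
    using assms by (auto simp: dist_norm mult_left_le)
  moreover have "(u * r + v * s) *\<^sub>R d = z - (u *\<^sub>R x + v *\<^sub>R y)"
    using pos by (simp add: d_def)
  then have "z = u *\<^sub>R (x + r *\<^sub>R d) + v *\<^sub>R (y + s *\<^sub>R d)"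
    by (simp add: algebra_simps)
  ultimately show ?thesis using that by blast
qed

lemma cball_subset_convex_combination:
  fixes x y :: "'a::real_normed_vector"
  assumes "convex W" "cball x r \<subseteq> W" "cball y s \<subseteq> W"
    "0 \<le> u" "0 \<le> v" "u + v = 1" "0 \<le> r" "0 \<le> s"
  shows "cball (u *\<^sub>R x + v *\<^sub>R y) (u * r + v * s) \<subseteq> W"
proof
  fix z assume "z \<in> cball (u *\<^sub>R x + v *\<^sub>R y) (u * r + v * s)"
  then obtain p q where "p \<in> cball x r" "q \<in> cball y s" "z = u *\<^sub>R p + v *\<^sub>R q"
    using convex_combination_cball assms by metis
  then show "z \<in> W" using assms convexD by blast
qed

lemma convex_inner_parallel:
  fixes W :: "'a::real_normed_vector set"
  assumes "convex W" "0 \<le> r"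
  shows "convex {x. cball x r \<subseteq> W}"
proof (rule convexI)
  fix x y :: 'a and u v :: real
  assume "x \<in> {x. cball x r \<subseteq> W}" "y \<in> {x. cball x r \<subseteq> W}" "0 \<le> u" "0 \<le> v" "u + v = 1"
  then show "u *\<^sub>R x + v *\<^sub>R y \<in> {x. cball x r \<subseteq> W}"
    using cball_subset_convex_combination[of W x r y r u v] assms
    by (simp add: distrib_right[symmetric])
qed

text \<open>The union of the inner balls is the sum of a closed set of centres and a compact ball.
  Closedness is what permits splitting the measure of the frontier along this set.\<close>

lemma closed_inner_ball_points:
  fixes W :: "'a::euclidean_space set"
  assumes "closed W" "0 \<le> r"
  shows "closed (inner_ball_points r W)"
proof -
  let ?K = "{x. cball x r \<subseteq> W}"
  have "inner_ball_points r W = frontier W \<inter> (\<Union>x\<in>?K. \<Union>y\<in>cball 0 r. {x + y})"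
    using assms(2) by (force simp: inner_ball_points_def dist_norm norm_minus_commute)
  moreover have "closed (\<Union>x\<in>?K. \<Union>y\<in>cball 0 r. {x + y})"
    using closed_compact_sums[OF closed_inner_parallel[OF assms(1)] compact_cball[of 0 r]]
    by (simp add: closed_inner_parallel assms)
  ultimately show ?thesis by (simp add: closed_Int)
qed

text \<open>The ball around a frontier point of the inner parallel body has to touch the frontier of
  \<open>W\<close>, and the contact point projects to the centre.\<close>

lemma frontier_inner_parallel:
  fixes W :: "'a::euclidean_space set"
  assumes "convex W" "closed W" "0 < r" and y: "y \<in> frontier {x. cball x r \<subseteq> W}"
  obtains p where "p \<in> inner_ball_points r W" "closest_point {x. cball x r \<subseteq> W} p = y"
proof -
  let ?K = "{x. cball x r \<subseteq> W}"
  have cl: "closed ?K" and cv: "convex ?K"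
    using closed_inner_parallel[OF assms(2)] convex_inner_parallel[OF assms(1)] assms(3) by simp_all
  have "y \<in> ?K" using y frontier_subset_closed[OF cl] by (rule rev_subsetD)
  then have yK: "cball y r \<subseteq> W" by simp
  \<comment> \<open>A compact ball in the open interior would leave a margin \<open>e\<close>, so
    all centres within \<open>e\<close> of \<open>y\<close> would be admissible and \<open>y\<close>
    would be interior.\<close>
  have "\<not> cball y r \<subseteq> interior W"
  proof
    assume "cball y r \<subseteq> interior W"
    then obtain e where e: "e > 0" "(\<Union>x\<in>cball y r. ball x e) \<subseteq> interior W"
      using compact_subset_open_imp_ball_epsilon_subset[OF compact_cball open_interior] by blast
    have "cball z r \<subseteq> W" if "z \<in> ball y e" for z
    proof
      fix w assume "w \<in> cball z r"
      then have "w - z + y \<in> cball y r" "w \<in> ball (w - z + y) e"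
        using that by (auto simp: dist_norm norm_minus_commute algebra_simps)
      then have "w \<in> interior W" using e(2) by (meson UN_I subsetD)
      then show "w \<in> W" using interior_subset by (rule rev_subsetD)
    qed
    then have "ball y e \<subseteq> ?K" by blast
    then have "y \<in> interior ?K" using e(1) by (metis mem_interior)
    then show False using y by (simp add: frontier_def)
  qed
  then obtain p where p: "p \<in> cball y r" "p \<notin> interior W" by blast
  then have "p \<in> frontier W"
    using yK assms(2) by (auto simp: frontier_def closure_closed)
  then have pS: "p \<in> inner_ball_points r W" using p yK by (auto simp: inner_ball_points_def)
  \<comment> \<open>A centre closer to \<open>p\<close> than \<open>y\<close> would have
    \<open>p\<close> in its open ball, hence in the interior of \<open>W\<close>.\<close>
  have "dist p y \<le> dist p x" if "x \<in> ?K" for x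
  proof (rule ccontr)
    assume "\<not> dist p y \<le> dist p x"
    then have "p \<in> ball x r" using p by (auto simp: dist_commute)
    moreover have "ball x r \<subseteq> interior W"
      using that by (intro interior_maximal) (auto simp: subset_iff)
    ultimately show False using p by blast
  qed
  then have "y = closest_point ?K p"
    using yK by (intro closest_point_unique cv cl) auto
  then show ?thesis using that pS by metis
qed

text \<open>\<open>f\<close> is the homothety with centre \<open>z\<close> and ratio
  \<open>t = 1 - r / c\<close>, and \<open>g\<close> is its inverse. Two projections, each
  1-Lipschitz, followed by \<open>g\<close> carry the touched points over the whole frontier;
  \<open>g\<close> contributes the constant \<open>1 / t\<close>.\<close>

lemma hausdorff_measure_frontier_le_inner_ball_points:
  fixes W :: "'a::euclidean_space set"
  assumes W: "convex W" "compact W" and z: "cball z c \<subseteq> W" and r: "0 < r" "r < c"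
  shows "hausdorff_measure m (frontier W)
    \<le> ennreal ((1 / (1 - r / c)) ^ m) * hausdorff_measure m (inner_ball_points r W)"
proof -
  define t where "t = 1 - r / c"
  have t: "0 < t" "t \<le> 1" using r by (auto simp: t_def)
  define f where "f x = (1 - t) *\<^sub>R z + t *\<^sub>R x" for x
  define g where "g y = (1 / t) *\<^sub>R (y - (1 - t) *\<^sub>R z)" for y
  have gf: "g (f x) = x" and fg: "f (g x) = x" for x using t by (auto simp: f_def g_def)
  let ?K = "{x. cball x r \<subseteq> W}"
  have K: "convex ?K" "closed ?K"
    using closed_inner_parallel[OF compact_imp_closed[OF W(2)]] convex_inner_parallel[OF W(1)] r by simp_all
  have KW: "?K \<subseteq> W"
  proof
    fix x assume "x \<in> ?K"
    moreover have "x \<in> cball x r" using r by simp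
    ultimately show "x \<in> W" by blast
  qed
  have fK: "f ` W \<subseteq> ?K"
  proof (clarify)
    fix x y assume x: "x \<in> W" "y \<in> cball (f x) r"
    \<comment> \<open>The point \<open>x\<close> enters as a ball of radius 0; the combined radius
      is \<open>(1 - t) * c = r\<close>.\<close>
    have "cball ((1 - t) *\<^sub>R z + t *\<^sub>R x) ((1 - t) * c + t * 0) \<subseteq> W"
      using t x r by (intro cball_subset_convex_combination W z) auto
    then show "y \<in> W" using x r by (auto simp: f_def t_def)
  qed
  have "f = (\<lambda>x. (1 - t) *\<^sub>R z + x) \<circ> (\<lambda>x. t *\<^sub>R x)" by (auto simp: f_def)
  then have fW: "f ` W = (\<lambda>x. (1 - t) *\<^sub>R z + x) ` ((\<lambda>x. t *\<^sub>R x) ` W)" by (simp add: image_comp)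
  have fWc: "convex (f ` W)" "compact (f ` W)"
    unfolding fW using W by (auto intro!: convex_translation convex_scaling compact_translation compact_scaling)
  have int_f: "ball (g y) (e / t) \<subseteq> W" if "ball y e \<subseteq> f ` W" for y e
  proof
    fix w assume "w \<in> ball (g y) (e / t)"
    then have "norm (g y - w) * t < e" using t by (simp add: dist_norm pos_less_divide_eq)
    moreover have "y - f w = t *\<^sub>R (g y - w)" using fg[of y] by (simp add: f_def algebra_simps)
    ultimately have "f w \<in> ball y e" using t by (simp add: dist_norm mult.commute)
    then show "w \<in> W" using that gf by (metis imageE subsetD)
  qed
  have f_int: "interior (f ` W) \<noteq> {}"
  proof -
    have "ball z (t * c) \<subseteq> f ` W"
    proof
      fix w assume "w \<in> ball z (t * c)"
      moreover have "z - w = t *\<^sub>R (z - g w)" using t by (simp add: g_def algebra_simps)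
      ultimately have "g w \<in> cball z c" using t by (auto simp: dist_norm)
      then show "w \<in> f ` W" using z fg by (metis image_eqI subsetD)
    qed
    then show ?thesis
      using t r centre_in_ball[of z "t * c"]
        by (metis empty_iff mem_interior mult_pos_pos order.strict_trans)
  qed
  have K_int: "interior ?K \<noteq> {}" using f_int interior_mono[OF fK] by blast
  have "frontier W \<subseteq> (\<lambda>p. g (closest_point (f ` W) (closest_point ?K p))) ` inner_ball_points r W"
  proof
    fix q assume q: "q \<in> frontier W"
    then have qW: "q \<in> W" using W frontier_subset_compact by blast
    have "f q \<notin> interior (f ` W)"
    proof
      assume "f q \<in> interior (f ` W)"
      then obtain e where "e > 0" "ball (f q) e \<subseteq> f ` W" by (auto simp: mem_interior)
      then have "0 < e / t" "ball q (e / t) \<subseteq> W" using int_f[of "f q" e] gf t by auto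
      then have "q \<in> interior W" unfolding mem_interior by blast
      then show False using q by (simp add: frontier_def)
    qed
    then have "f q \<in> frontier (f ` W)"
      using qW closure_subset[of "f ` W"] by (auto simp: frontier_def)
    moreover have "compact ?K" using compact_Int_closed[OF W(2) K(2)] KW by (simp add: Int_absorb1)
    ultimately obtain y where y: "y \<in> frontier ?K" "closest_point (f ` W) y = f q"
      using frontier_exit_point_bounded[OF fWc(1) compact_imp_closed[OF fWc(2)] f_int _ _ fK] by metis
    obtain p where "p \<in> inner_ball_points r W" "closest_point ?K p = y"
      using frontier_inner_parallel[OF W(1) compact_imp_closed[OF W(2)] r(1) y(1)] by blast
    then show "q \<in> (\<lambda>p. g (closest_point (f ` W) (closest_point ?K p))) ` inner_ball_points r W"
      using y gf by (intro image_eqI[of _ _ p]) auto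
  qed
  then have "hausdorff_measure m (frontier W)
      \<le> hausdorff_measure m ((\<lambda>p. g (closest_point (f ` W) (closest_point ?K p))) ` inner_ball_points r W)"
    by (rule hausdorff_measure_mono)
  also have "\<dots> \<le> ennreal ((1 / t) ^ m) * hausdorff_measure m (inner_ball_points r W)"
  proof (rule hausdorff_measure_lipschitz_image)
    fix x y
    let ?x = "closest_point (f ` W) (closest_point ?K x)" and ?y = "closest_point (f ` W) (closest_point ?K y)"
    have "dist (g ?x) (g ?y) = (1 / t) * dist ?x ?y"
      using t by (simp add: g_def dist_norm scaleR_diff_right[symmetric] del: scaleR_diff_right)
    also have "dist ?x ?y \<le> dist (closest_point ?K x) (closest_point ?K y)"
      using fWc f_int by (intro closest_point_lipschitz) (auto simp: compact_imp_closed)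
    also have "dist (closest_point ?K x) (closest_point ?K y) \<le> dist x y"
      using K_int by (intro closest_point_lipschitz K) auto
    finally show "dist (g ?x) (g ?y) \<le> 1 / t * dist x y" using t by (simp add: divide_right_mono)
  qed (use t in simp)
  finally show ?thesis by (simp add: t_def)
qed

text \<open>With total area \<open>s\<close>, the touched points have area at least
  \<open>(1 - r / c) ^ (n - 1) * s\<close>. Additivity leaves at most
  \<open>(1 - (1 - r / c) ^ (n - 1)) * s\<close> for the rest, and this tends to 0 with
  \<open>r\<close>. Real numbers replace extended ones so that subtraction is available.\<close>

lemma eventually_inner_ball_points:
  fixes W :: "'a::euclidean_space set"
  assumes W: "convex W" "compact W" "interior W \<noteq> {}" and e: "0 < e"
  shows "\<forall>\<^sub>F r in at_right 0.
    hausdorff_measure (DIM('a) - 1) (frontier W - inner_ball_points r W) < ennreal e"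
proof -
  let ?m = "DIM('a) - 1"
  obtain z where "z \<in> interior W" using W(3) by blast
  then obtain c where c: "0 < c" "cball z c \<subseteq> W" using mem_interior_cball by blast
  define s where "s = enn2real (hausdorff_measure ?m (frontier W))"
  have s: "hausdorff_measure ?m (frontier W) = ennreal s" "0 \<le> s"
    using hausdorff_measure_frontier_finite[OF W] by (auto simp: s_def less_top)
  have "((\<lambda>r. (1 - (1 - r / c) ^ ?m) * s) \<longlongrightarrow> (1 - (1 - 0 / c) ^ ?m) * s) (at_right 0)"
    using c by (intro tendsto_intros) auto
  then have "\<forall>\<^sub>F r in at_right 0. (1 - (1 - r / c) ^ ?m) * s < e"
    using e by (intro order_tendstoD) auto
  moreover have "\<forall>\<^sub>F r in at_right 0. r \<in> {0<..<c}"
    using c by (intro eventually_at_right_real)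
  ultimately show ?thesis
  proof eventually_elim
    case (elim r)
    then have r: "0 < r" "r < c" by auto
    define t where "t = 1 - r / c"
    have t: "0 < t" using r by (simp add: t_def)
    let ?H = "hausdorff_measure ?m"
    have sub: "inner_ball_points r W \<subseteq> frontier W" by (auto simp: inner_ball_points_def)
    have le_s: "?H (inner_ball_points r W) \<le> ennreal s"
      using hausdorff_measure_mono[OF sub] s by metis
    define a where "a = enn2real (?H (inner_ball_points r W))"
    have "?H (inner_ball_points r W) < top"
      using le_s by (rule le_less_trans) simp
    then have a: "?H (inner_ball_points r W) = ennreal a" "0 \<le> a"
      by (simp_all add: a_def)
    have split: "ennreal a + ?H (frontier W - inner_ball_points r W) \<le> ennreal s"
      using hausdorff_measure_Int_Diff_closed[OF closed_inner_ball_points[OF compact_imp_closed[OF W(2)]], of r ?m "frontier W"]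
        r sub s a by (simp add: Int_absorb1)
    define b where "b = enn2real (?H (frontier W - inner_ball_points r W))"
    have "?H (frontier W - inner_ball_points r W) \<le> ennreal s"
      by (rule order_trans[OF _ split]) simp
    then have "?H (frontier W - inner_ball_points r W) < top"
      by (rule le_less_trans) simp
    then have b: "?H (frontier W - inner_ball_points r W) = ennreal b" "0 \<le> b"
      by (simp_all add: b_def)
    have "a + b \<le> s" using split a b s by (simp add: ennreal_plus[symmetric] del: ennreal_plus)
    moreover have "s \<le> (1 / t) ^ ?m * a"
      using hausdorff_measure_frontier_le_inner_ball_points[OF W(1,2) c(2) r, of ?m] s a t
      by (simp add: t_def ennreal_mult'[symmetric])
    then have "t ^ ?m * s \<le> a" using t by (simp add: field_simps)
    ultimately have "b \<le> (1 - t ^ ?m) * s" by (simp add: algebra_simps)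
    then show ?case using elim(1) b e by (simp add: t_def ennreal_lessI)
  qed
qed

text \<open>The parameters may come in either order, since the outside point is sometimes ahead of
  and sometimes behind the inside one.\<close>

lemma frontier_on_segment:
  fixes W :: "'a::real_normed_vector set"
  assumes "z + s *\<^sub>R u \<in> W" "z + t *\<^sub>R u \<notin> W"
  obtains w where "min s t \<le> w" "w \<le> max s t" "z + w *\<^sub>R u \<in> frontier W"
proof -
  have "closed_segment (z + s *\<^sub>R u) (z + t *\<^sub>R u) \<inter> frontier W \<noteq> {}"
    using assms by (intro connected_Int_frontier) auto
  then obtain x where x: "x \<in> closed_segment (z + s *\<^sub>R u) (z + t *\<^sub>R u)" "x \<in> frontier W" by blast
  obtain k where k: "0 \<le> k" "k \<le> 1" "x = z + (s + k * (t - s)) *\<^sub>R u"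
    using x(1) by (auto simp: in_segment algebra_simps)
  show ?thesis
  proof (rule that)
    show "z + (s + k * (t - s)) *\<^sub>R u \<in> frontier W" using x k by simp
    show "min s t \<le> s + k * (t - s)"
    proof (cases "s \<le> t")
      case False
      then have "k * (s - t) \<le> 1 * (s - t)" using k by (intro mult_right_mono) auto
      then show ?thesis by (simp add: algebra_simps min_def)
    qed (use k in simp)
    show "s + k * (t - s) \<le> max s t"
    proof (cases "s \<le> t")
      case True
      then have "k * (t - s) \<le> 1 * (t - s)" using k by (intro mult_right_mono) auto
      then show ?thesis by (simp add: algebra_simps max_def)
    next
      case False
      then have "k * (t - s) \<le> 0" using k by (intro mult_nonneg_nonpos) auto
      then show ?thesis by (simp add: max_def)
    qed
  qed
qed

section \<open>Positivity of the surface measure\<close>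

lemma not_ball_subset_tube:
  fixes E :: "'a::euclidean_space set"
  assumes E: "hausdorff_measure (DIM('a) - 1) E = 0" and u: "norm u = 1" and \<rho>: "0 < \<rho>"
  shows "\<not> ball z \<rho> \<subseteq> {q + s *\<^sub>R u | q s. q \<in> E \<and> \<bar>s\<bar> \<le> 1}"
proof
  let ?m = "DIM('a) - 1"
  define \<omega> where "\<omega> = unit_ball_vol (real ?m)"
  define \<omega>' where "\<omega>' = unit_ball_vol (real DIM('a))"
  have n: "DIM('a) = Suc ?m" by simp
  have \<omega>: "0 < \<omega>" "0 < \<omega>'" unfolding \<omega>_def \<omega>'_def by simp_all
  \<comment> \<open>The factor 8 comes from the number of balls, at most \<open>8 / x\<close>;
    \<open>\<omega>' * 2 ^ n\<close> from the volume of a ball of radius \<open>2 * x\<close>; the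
    last factor converts \<open>d ^ (n - 1)\<close> plus an error into the gauge plus that
    error.\<close>
  define K where "K = 8 * \<omega>' * 2 ^ DIM('a) * (2 ^ ?m / \<omega> + 1)"
  have K: "0 < K" unfolding K_def using \<omega> by (intro mult_pos_pos add_pos_pos) auto
  assume sub: "ball z \<rho> \<subseteq> {q + s *\<^sub>R u | q s. q \<in> E \<and> \<bar>s\<bar> \<le> 1}"
  have "emeasure lborel (ball z \<rho>) \<le> ennreal (K * (2 * e))" if e: "0 < e" for e
  proof -
    have "hausdorff_premeasure ?m 1 E < ennreal e"
      using hausdorff_premeasure_le_measure[of 1 ?m E] E e by simp
    then obtain C where C: "fine_cover 1 E C" and Ce: "(\<Sum>i. hausdorff_gauge ?m (C i)) < ennreal e"
      using hausdorff_premeasure_approx by blast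
    have ex: "\<exists>B. B \<in> sets lborel \<and> {q + s *\<^sub>R u | q s. q \<in> C i \<and> \<bar>s\<bar> \<le> 1} \<subseteq> B \<and>
        emeasure lborel B \<le> ennreal K * (hausdorff_gauge ?m (C i) + ennreal (e * (1/2) ^ Suc i))" for i
    proof (cases "C i = {}")
      case False
      then obtain c where c: "c \<in> C i" by blast
      have bd: "bounded (C i)" "diameter (C i) \<le> 1" using C by (auto simp: fine_cover_def)
      define d where "d = diameter (C i)"
      have d: "0 \<le> d" "d \<le> 1" using bd diameter_ge_0 by (auto simp: d_def)
      \<comment> \<open>The diameter \<open>d\<close> may be 0, so the ball size is a slightly
        larger \<open>x\<close>, whose excess is absorbed by the error
        \<open>e / 2 ^ (i + 1)\<close>.\<close>
      have "((\<lambda>x. x ^ ?m) \<longlongrightarrow> d ^ ?m) (at_right d)" by (intro tendsto_intros)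
      then have "\<forall>\<^sub>F x in at_right d. x ^ ?m < d ^ ?m + e * (1/2) ^ Suc i"
        using e by (intro order_tendstoD) auto
      moreover have "\<forall>\<^sub>F x in at_right d. x \<in> {d<..<2}"
        using d by (intro eventually_at_right_real) auto
      ultimately have "\<forall>\<^sub>F x in at_right d. x ^ ?m < d ^ ?m + e * (1/2) ^ Suc i \<and> x \<in> {d<..<2}"
        by (rule eventually_conj)
      then obtain x where x: "x ^ ?m < d ^ ?m + e * (1/2) ^ Suc i" "d < x" "x < 2"
        using eventually_happens'[OF trivial_limit_at_right_real] by fastforce
      have x0: "0 < x" using x d by linarith
      define N where "N = \<lceil>1 / x\<rceil>"
      let ?J = "{- N .. N}"
      \<comment> \<open>about \<open>2 / x\<close> balls of radius \<open>2 * x\<close>, hence of total volume of order \<open>x ^ (n - 1)\<close>\<close>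
      define B where "B = (\<Union>j\<in>?J. cball (c + (real_of_int j * x) *\<^sub>R u) (2 * x))"
      have N1: "1 / x \<le> real_of_int N" "real_of_int N < 1 / x + 1" unfolding N_def by linarith+
      have "0 < 1 / x" using x0 by simp
      then have "0 \<le> N" using N1 by linarith
      then have cardJ: "real (card ?J) = 2 * real_of_int N + 1" by simp
      \<comment> \<open>The left side is below \<open>2 / x + 3\<close>, and \<open>x < 2\<close>
        gives \<open>3 \<le> 6 / x\<close>.\<close>
      have "2 * real_of_int N + 1 \<le> 8 / x"
      proof -
        have "3 \<le> 6 / x" using x x0 by (simp add: field_simps)
        then show ?thesis using N1 by linarith
      qed
      then have cardJ8: "real (card ?J) \<le> 8 / x" using cardJ by linarith
      have "emeasure lborel B \<le> (\<Sum>j\<in>?J. emeasure lborel (cball (c + (real_of_int j * x) *\<^sub>R u) (2 * x)))"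
        unfolding B_def by (intro emeasure_subadditive_finite) auto
      also have "\<dots> = ennreal (real (card ?J) * (\<omega>' * (2 * x) ^ DIM('a)))"
        using x0
          by (simp add: emeasure_cball \<omega>'_def ennreal_of_nat_eq_real_of_nat ennreal_mult'[symmetric] del: card_atLeastAtMost_int)
      also have "\<dots> \<le> ennreal (8 / x * (\<omega>' * (2 * x) ^ DIM('a)))"
        using cardJ8 x0 \<omega> by (intro ennreal_leI mult_right_mono) auto
      also have "(2 * x) ^ DIM('a) = 2 ^ DIM('a) * (x * x ^ ?m)"
        by (metis n power_Suc power_mult_distrib)
      also have "8 / x * (\<omega>' * (2 ^ DIM('a) * (x * x ^ ?m))) = 8 * \<omega>' * 2 ^ DIM('a) * x ^ ?m"
        using x0 by simp
      also have "ennreal \<dots> \<le> ennreal (K * (\<omega> * (d / 2) ^ ?m + e * (1/2) ^ Suc i))"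
      proof (rule ennreal_leI)
        have "8 * \<omega>' * 2 ^ DIM('a) * x ^ ?m \<le> 8 * \<omega>' * 2 ^ DIM('a) * (d ^ ?m + e * (1/2) ^ Suc i)"
          using x(1) \<omega> by (intro mult_left_mono) auto
        moreover have "d ^ ?m + e * (1/2) ^ Suc i \<le> (2 ^ ?m / \<omega> + 1) * (\<omega> * (d / 2) ^ ?m + e * (1/2) ^ Suc i)"
        proof -
          have "(2 ^ ?m / \<omega> + 1) * (\<omega> * (d / 2) ^ ?m + e * (1/2) ^ Suc i)
             = 2 ^ ?m * (d / 2) ^ ?m + e * (1/2) ^ Suc i + (\<omega> * (d / 2) ^ ?m + 2 ^ ?m / \<omega> * (e * (1/2) ^ Suc i))"
            using \<omega>(1) by (simp add: distrib_right distrib_left)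
          moreover have "2 ^ ?m * (d / 2) ^ ?m = d ^ ?m"
            by (simp add: power_mult_distrib[symmetric])
          ultimately show ?thesis using \<omega>(1) d e by simp
        qed
        ultimately have "8 * \<omega>' * 2 ^ DIM('a) * x ^ ?m \<le> 8 * \<omega>' * 2 ^ DIM('a) * ((2 ^ ?m / \<omega> + 1) * (\<omega> * (d / 2) ^ ?m + e * (1/2) ^ Suc i))"
          using \<omega>
            by (meson mult_left_mono mult_nonneg_nonneg less_imp_le order_trans zero_le_numeral zero_le_power)
        then show "8 * \<omega>' * 2 ^ DIM('a) * x ^ ?m \<le> K * (\<omega> * (d / 2) ^ ?m + e * (1/2) ^ Suc i)"
          by (simp add: K_def mult.assoc)
      qed
      also have "\<dots> = ennreal K * (hausdorff_gauge ?m (C i) + ennreal (e * (1/2) ^ Suc i))"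
      proof -
        have "hausdorff_gauge ?m (C i) = ennreal (\<omega> * (d / 2) ^ ?m)"
          unfolding hausdorff_gauge_def \<omega>_def[symmetric] d_def[symmetric] using False by (simp only: if_False)
        moreover have "0 \<le> \<omega> * (d / 2) ^ ?m" "0 \<le> e * (1/2) ^ Suc i" using d e \<omega> by simp_all
        ultimately show ?thesis using K by (simp only: ennreal_mult'[OF less_imp_le] ennreal_plus)
      qed
      finally have "emeasure lborel B \<le> ennreal K * (hausdorff_gauge ?m (C i) + ennreal (e * (1/2) ^ Suc i))" .
      moreover have "{q + s *\<^sub>R u | q s. q \<in> C i \<and> \<bar>s\<bar> \<le> 1} \<subseteq> B"
      proof clarify
        fix q s assume q: "q \<in> C i" "\<bar>s\<bar> \<le> (1::real)"
        \<comment> \<open>Rounding \<open>s / x\<close> toward zero keeps \<open>j\<close> between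
          \<open>- N\<close> and \<open>N\<close> and leaves an error of at most
          \<open>x\<close>.\<close>
        define j where "j = (if 0 \<le> s then \<lfloor>s / x\<rfloor> else - \<lfloor>- s / x\<rfloor>)"
        have fl: "0 \<le> \<lfloor>\<bar>s\<bar> / x\<rfloor>" "\<lfloor>\<bar>s\<bar> / x\<rfloor> \<le> N" "\<bar>\<bar>s\<bar> - real_of_int \<lfloor>\<bar>s\<bar> / x\<rfloor> * x\<bar> \<le> x"
        proof -
          show "0 \<le> \<lfloor>\<bar>s\<bar> / x\<rfloor>" using x0 by simp
          have "\<bar>s\<bar> / x \<le> 1 / x" using q x0 by (intro divide_right_mono) auto
          then have "real_of_int \<lfloor>\<bar>s\<bar> / x\<rfloor> \<le> real_of_int N" using N1 by linarith
          then show "\<lfloor>\<bar>s\<bar> / x\<rfloor> \<le> N" by simp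
          have "real_of_int \<lfloor>\<bar>s\<bar> / x\<rfloor> \<le> \<bar>s\<bar> / x" "\<bar>s\<bar> / x \<le> real_of_int \<lfloor>\<bar>s\<bar> / x\<rfloor> + 1" by linarith+
          then have "real_of_int \<lfloor>\<bar>s\<bar> / x\<rfloor> * x \<le> \<bar>s\<bar>" "\<bar>s\<bar> \<le> (real_of_int \<lfloor>\<bar>s\<bar> / x\<rfloor> + 1) * x"
            by (simp_all only: pos_le_divide_eq[OF x0] pos_divide_le_eq[OF x0])
          then show "\<bar>\<bar>s\<bar> - real_of_int \<lfloor>\<bar>s\<bar> / x\<rfloor> * x\<bar> \<le> x" by (simp add: distrib_right)
        qed
        define k where "k = \<lfloor>\<bar>s\<bar> / x\<rfloor>"
        have k: "0 \<le> k" "k \<le> N" "\<bar>\<bar>s\<bar> - real_of_int k * x\<bar> \<le> x" using fl by (simp_all only: k_def)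
        have j: "0 \<le> s \<and> j = k \<or> s < 0 \<and> j = - k" by (auto simp: j_def k_def)
        have jJ: "j \<in> ?J" using j k(1,2) by auto
        have js: "\<bar>s - real_of_int j * x\<bar> \<le> x" using j k(3) by auto
        have "dist q c \<le> d" using diameter_bounded_bound[OF bd(1) q(1) c] by (simp add: d_def)
        then have "norm ((q - c) + (s - real_of_int j * x) *\<^sub>R u) \<le> d + x"
          using js u by (intro norm_triangle_mono) (auto simp: dist_norm)
        moreover have "(q - c) + (s - real_of_int j * x) *\<^sub>R u = (q + s *\<^sub>R u) - (c + (real_of_int j * x) *\<^sub>R u)"
          by (simp add: algebra_simps)
        ultimately have "q + s *\<^sub>R u \<in> cball (c + (real_of_int j * x) *\<^sub>R u) (2 * x)"
          using x(2) by (simp add: dist_norm norm_minus_commute)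
        then show "q + s *\<^sub>R u \<in> B" using jJ unfolding B_def by blast
      qed
      moreover have "B \<in> sets lborel" unfolding B_def by auto
      ultimately show ?thesis by blast
    qed (auto intro!: exI[of _ "{}"])
    have "\<exists>B. \<forall>i. B i \<in> sets lborel \<and> {q + s *\<^sub>R u | q s. q \<in> C i \<and> \<bar>s\<bar> \<le> 1} \<subseteq> B i \<and>
        emeasure lborel (B i) \<le> ennreal K * (hausdorff_gauge ?m (C i) + ennreal (e * (1/2) ^ Suc i))"
      using ex by (intro choice allI)
    then obtain B where B: "\<And>i. B i \<in> sets lborel"
      "\<And>i. {q + s *\<^sub>R u | q s. q \<in> C i \<and> \<bar>s\<bar> \<le> 1} \<subseteq> B i"
      "\<And>i. emeasure lborel (B i) \<le> ennreal K * (hausdorff_gauge ?m (C i) + ennreal (e * (1/2) ^ Suc i))"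
      by blast
    have "ball z \<rho> \<subseteq> (\<Union>i. B i)"
    proof
      fix w assume "w \<in> ball z \<rho>"
      then obtain q s where qs: "w = q + s *\<^sub>R u" "q \<in> E" "\<bar>s\<bar> \<le> 1" using sub by blast
      obtain i where "q \<in> C i" using qs C unfolding fine_cover_def by blast
      then have "w \<in> B i" using B(2)[of i] qs by blast
      then show "w \<in> (\<Union>i. B i)" by blast
    qed
    then have "emeasure lborel (ball z \<rho>) \<le> emeasure lborel (\<Union>i. B i)"
      using B(1) by (intro emeasure_mono) auto
    also have "\<dots> \<le> (\<Sum>i. emeasure lborel (B i))"
      using B(1) by (intro emeasure_subadditive_countably) auto
    also have "\<dots> \<le> (\<Sum>i. ennreal K * (hausdorff_gauge ?m (C i) + ennreal (e * (1/2) ^ Suc i)))"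
      using B(3) by (intro suminf_le) auto
    also have "\<dots> = ennreal K * ((\<Sum>i. hausdorff_gauge ?m (C i)) + (\<Sum>i. ennreal (e * (1/2) ^ Suc i)))"
      by (subst suminf_add) auto
    also have "(\<Sum>i. ennreal (e * (1/2) ^ Suc i)) = ennreal e"
    proof -
      have "(\<lambda>i. e * (1/2) ^ Suc i) sums (e * 1)"
        by (intro sums_mult power_half_series)
      then show ?thesis using e by (intro suminf_ennreal_eq) auto
    qed
    also have "ennreal K * ((\<Sum>i. hausdorff_gauge ?m (C i)) + ennreal e) \<le> ennreal K * (ennreal e + ennreal e)"
      using Ce by (intro mult_left_mono add_right_mono) auto
    also have "\<dots> = ennreal (K * (2 * e))"
      using e K by (simp add: ennreal_mult'' ennreal_plus[symmetric] del: ennreal_plus)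
    finally show ?thesis .
  qed
  moreover have v: "emeasure lborel (ball z \<rho>) = ennreal (\<omega>' * \<rho> ^ DIM('a))"
    using \<rho> by (simp add: emeasure_ball \<omega>'_def)
  moreover have vpos: "0 < \<omega>' * \<rho> ^ DIM('a)" using \<omega> \<rho> by simp
  ultimately have "\<omega>' * \<rho> ^ DIM('a) \<le> K * (2 * e)" if "0 < e" for e
    using that K by (metis ennreal_le_iff mult_nonneg_nonneg less_imp_le zero_le_numeral)
  \<comment> \<open>With this \<open>e\<close> the bound says that the volume of the ball is at most
    half of itself.\<close>
  from this[of "\<omega>' * \<rho> ^ DIM('a) / (4 * K)"] show False using vpos K by simp
qed

text \<open>Let \<open>u\<close> point from \<open>p\<close> to an interior point. Every line of
  direction \<open>u\<close> close to \<open>p\<close> passes from the interior to the outside of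
  \<open>W\<close> near \<open>p\<close>, so the tube around this piece of frontier contains a ball
  and the piece cannot be null.\<close>

lemma hausdorff_measure_frontier_ball_pos:
  fixes W :: "'a::euclidean_space set"
  assumes W: "convex W" "closed W" "interior W \<noteq> {}" and p: "p \<in> frontier W" and \<delta>: "0 < \<delta>"
  shows "0 < hausdorff_measure (DIM('a) - 1) (frontier W \<inter> ball p \<delta>)"
proof (rule ccontr)
  assume "\<not> ?thesis"
  then have null: "hausdorff_measure (DIM('a) - 1) (frontier W \<inter> ball p \<delta>) = 0" by simp
  obtain a where a: "a \<in> interior W" using W(3) by blast
  have pa: "p \<noteq> a" "p \<in> W" "p \<notin> interior W"
    using p a W(2) frontier_subset_closed by (auto simp: frontier_def)
  define u where "u = (a - p) /\<^sub>R norm (a - p)"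
  have u: "norm u = 1" using pa by (simp add: u_def)
  define \<tau> where "\<tau> = min (min (\<delta> / 2) 1) (norm (a - p) / 2)"
  have \<tau>: "0 < \<tau>" "\<tau> \<le> \<delta> / 2" "\<tau> \<le> 1" "\<tau> < norm (a - p)"
    using \<delta> pa by (auto simp: \<tau>_def min_less_iff_disj)
  have a_eq: "a = p + norm (a - p) *\<^sub>R u" using pa by (simp add: u_def)
  have inW: "p + \<tau> *\<^sub>R u \<in> interior W"
  proof -
    let ?k = "\<tau> / norm (a - p)"
    have "p - ?k *\<^sub>R (p - a) \<in> interior W"
      using \<tau> pa by (intro mem_interior_convex_shrink W a) auto
    then show ?thesis by (simp add: u_def divide_inverse algebra_simps)
  qed
  have outW: "p - \<tau> *\<^sub>R u \<notin> W"
  proof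
    assume b: "p - \<tau> *\<^sub>R u \<in> W"
    \<comment> \<open>This is the ratio at which \<open>p\<close> divides the segment from
      \<open>p - \<tau> *\<^sub>R u\<close> to \<open>a\<close>; shrinking toward the interior point
      \<open>a\<close> would make \<open>p\<close> interior.\<close>
    let ?k = "\<tau> / (\<tau> + norm (a - p))"
    have "(p - \<tau> *\<^sub>R u) - ?k *\<^sub>R ((p - \<tau> *\<^sub>R u) - a) \<in> interior W"
      using \<tau> pa by (intro mem_interior_convex_shrink W a b) (auto simp: divide_simps)
    moreover have "(p - \<tau> *\<^sub>R u) - a = - ((\<tau> + norm (a - p)) *\<^sub>R u)"
      by (subst a_eq) (simp add: algebra_simps)
    moreover have "\<tau> + norm (a - p) \<noteq> 0" using \<tau> by (metis add_pos_nonneg norm_ge_zero less_irrefl)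
    ultimately show False using pa by simp
  qed
  obtain e1 where e1: "e1 > 0" "ball (p + \<tau> *\<^sub>R u) e1 \<subseteq> W"
    using inW mem_interior by blast
  have "open (- W)" using W by auto
  then obtain e2 where e2: "e2 > 0" "ball (p - \<tau> *\<^sub>R u) e2 \<subseteq> - W"
    using outW open_contains_ball by blast
  define \<eta> where "\<eta> = min (\<delta> / 2) (min e1 e2)"
  have \<eta>: "0 < \<eta>" "\<eta> \<le> \<delta> / 2" "\<eta> \<le> e1" "\<eta> \<le> e2" using e1 e2 \<delta> by (auto simp: \<eta>_def)
  have "ball p \<eta> \<subseteq> {q + s *\<^sub>R u | q s. q \<in> frontier W \<inter> ball p \<delta> \<and> \<bar>s\<bar> \<le> 1}"
  proof
    fix z assume z: "z \<in> ball p \<eta>"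
    then have "z + \<tau> *\<^sub>R u \<in> ball (p + \<tau> *\<^sub>R u) e1" "z - \<tau> *\<^sub>R u \<in> ball (p - \<tau> *\<^sub>R u) e2"
      using \<eta> by (auto simp: dist_norm)
    then have "z + \<tau> *\<^sub>R u \<in> W" "z + (- \<tau>) *\<^sub>R u \<notin> W" using e1 e2 by auto
    then obtain w where w: "min \<tau> (- \<tau>) \<le> w" "w \<le> max \<tau> (- \<tau>)" "z + w *\<^sub>R u \<in> frontier W"
      using frontier_on_segment by metis
    have w\<tau>: "\<bar>w\<bar> \<le> \<tau>" using w \<tau> by auto
    have "norm ((p - z) + (- w) *\<^sub>R u) < \<eta> + \<tau>"
      using z w\<tau> u norm_triangle_ineq[of "p - z" "(- w) *\<^sub>R u"] by (simp add: dist_norm)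
    then have "z + w *\<^sub>R u \<in> ball p \<delta>" using \<eta> \<tau> by (simp add: dist_norm algebra_simps)
    moreover have "z = (z + w *\<^sub>R u) + (- w) *\<^sub>R u" by simp
    ultimately show "z \<in> {q + s *\<^sub>R u | q s. q \<in> frontier W \<inter> ball p \<delta> \<and> \<bar>s\<bar> \<le> 1}"
      using w(3) w\<tau> \<tau>(3) by (smt (verit) Int_iff abs_minus_cancel mem_Collect_eq)
  qed
  then show False using not_ball_subset_tube[OF null u \<eta>(1)] by blast
qed

section \<open>Inner balls and regularity\<close>

text \<open>The extreme point \<open>x + s *\<^sub>R u\<close> of the ball lies in \<open>V\<close>,
  which forces \<open>s \<le> u \<bullet> (q - x)\<close>. As \<open>q - x\<close> has norm at most
  \<open>s\<close>, it must equal \<open>s *\<^sub>R u\<close>.\<close>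

lemma inner_ball_centre:
  fixes V :: "'a::euclidean_space set"
  assumes "cball x s \<subseteq> V" "q \<in> cball x s" "0 < s" "norm u = 1" "\<And>z. z \<in> V \<Longrightarrow> u \<bullet> (z - q) \<le> 0"
  shows "x = q - s *\<^sub>R u"
proof -
  have "x + s *\<^sub>R u \<in> V" using assms(1,3,4) by (auto simp: subset_iff dist_norm)
  then have "u \<bullet> (x + s *\<^sub>R u - q) \<le> 0" by (rule assms(5))
  then have le: "s \<le> u \<bullet> (q - x)"
    using assms(4) by (simp add: inner_diff_right inner_add_right dot_square_norm)
  have "norm (q - x) \<le> s" using assms(2) by (simp add: dist_norm norm_minus_commute)
  then have "norm (q - x) ^ 2 \<le> s ^ 2" by (intro power_mono) auto
  moreover have "norm (w - s *\<^sub>R u) ^ 2 = norm w ^ 2 - 2 * s * (u \<bullet> w) + s ^ 2 * norm u ^ 2" for w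
    unfolding power2_norm_eq_inner by (simp add: inner_diff inner_commute algebra_simps power2_eq_square)
  then have "norm ((q - x) - s *\<^sub>R u) ^ 2 = norm (q - x) ^ 2 - 2 * s * (u \<bullet> (q - x)) + s ^ 2"
    using assms(4) by simp
  moreover have "s * s \<le> s * (u \<bullet> (q - x))" using le assms(3) by (intro mult_left_mono) auto
  ultimately have "norm ((q - x) - s *\<^sub>R u) ^ 2 \<le> 0" by (simp add: power2_eq_square)
  then show ?thesis by (simp add: algebra_simps)
qed

text \<open>The support inequality at \<open>q\<^sub>2\<close> is tested with the point of the ball
  touching at \<open>q\<^sub>1\<close> that is extreme in direction
  \<open>u\<^sub>2\<close>.\<close>

lemma unit_normal_gap:
  fixes V :: "'a::euclidean_space set"
  assumes "norm u\<^sub>1 = 1" "norm u\<^sub>2 = 1" "0 < s" "cball (q\<^sub>1 - s *\<^sub>R u\<^sub>1) s \<subseteq> V"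
    "\<And>z. z \<in> V \<Longrightarrow> u\<^sub>2 \<bullet> (z - q\<^sub>2) \<le> 0"
  shows "s * norm (u\<^sub>1 - u\<^sub>2) ^ 2 \<le> 2 * (u\<^sub>2 \<bullet> (q\<^sub>2 - q\<^sub>1))"
proof -
  have "q\<^sub>1 - s *\<^sub>R u\<^sub>1 + s *\<^sub>R u\<^sub>2 \<in> V" using assms(1-4) by (auto simp: subset_iff dist_norm)
  then have "u\<^sub>2 \<bullet> (q\<^sub>1 - s *\<^sub>R u\<^sub>1 + s *\<^sub>R u\<^sub>2 - q\<^sub>2) \<le> 0" by (rule assms(5))
  then have "s * (1 - u\<^sub>1 \<bullet> u\<^sub>2) \<le> u\<^sub>2 \<bullet> (q\<^sub>2 - q\<^sub>1)"
    using assms(2)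
      by (simp add: inner_diff_right inner_add_right dot_square_norm inner_commute algebra_simps)
  moreover have "norm (u\<^sub>1 - u\<^sub>2) ^ 2 = 2 - 2 * (u\<^sub>1 \<bullet> u\<^sub>2)"
    using assms(1,2)
      by (simp add: power2_norm_eq_inner inner_diff inner_commute) (simp add: dot_square_norm)
  then have "s * norm (u\<^sub>1 - u\<^sub>2) ^ 2 = 2 * (s * (1 - u\<^sub>1 \<bullet> u\<^sub>2))"
    by (elim ssubst) (simp add: algebra_simps)
  ultimately show ?thesis by linarith
qed

text \<open>Adding the gap inequality for both orders of the points bounds
  \<open>s * norm (u\<^sub>1 - u\<^sub>2) ^ 2\<close> by an inner product, and Cauchy-Schwarz
  finishes.\<close>

lemma unit_normal_lipschitz:
  fixes V :: "'a::euclidean_space set"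
  assumes "norm u\<^sub>1 = 1" "norm u\<^sub>2 = 1" "0 < s"
    "cball (q\<^sub>1 - s *\<^sub>R u\<^sub>1) s \<subseteq> V" "cball (q\<^sub>2 - s *\<^sub>R u\<^sub>2) s \<subseteq> V"
    "\<And>z. z \<in> V \<Longrightarrow> u\<^sub>1 \<bullet> (z - q\<^sub>1) \<le> 0" "\<And>z. z \<in> V \<Longrightarrow> u\<^sub>2 \<bullet> (z - q\<^sub>2) \<le> 0"
  shows "norm (u\<^sub>1 - u\<^sub>2) \<le> norm (q\<^sub>1 - q\<^sub>2) / s"
proof (cases "u\<^sub>1 = u\<^sub>2")
  case False
  have "s * norm (u\<^sub>1 - u\<^sub>2) ^ 2 \<le> 2 * (u\<^sub>2 \<bullet> (q\<^sub>2 - q\<^sub>1))"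
    by (rule unit_normal_gap) (use assms in auto)
  moreover have "s * norm (u\<^sub>2 - u\<^sub>1) ^ 2 \<le> 2 * (u\<^sub>1 \<bullet> (q\<^sub>1 - q\<^sub>2))"
    by (rule unit_normal_gap) (use assms in auto)
  ultimately have "s * norm (u\<^sub>1 - u\<^sub>2) ^ 2 \<le> (u\<^sub>1 - u\<^sub>2) \<bullet> (q\<^sub>1 - q\<^sub>2)"
    by (simp add: norm_minus_commute inner_diff algebra_simps)
  also have "\<dots> \<le> norm (u\<^sub>1 - u\<^sub>2) * norm (q\<^sub>1 - q\<^sub>2)" by (rule norm_cauchy_schwarz)
  finally have "norm (u\<^sub>1 - u\<^sub>2) * (s * norm (u\<^sub>1 - u\<^sub>2)) \<le> norm (u\<^sub>1 - u\<^sub>2) * norm (q\<^sub>1 - q\<^sub>2)"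
    by (simp add: power2_eq_square mult_ac)
  then show ?thesis using False assms(3) by (simp add: pos_le_divide_eq mult.commute)
qed (use assms in simp)

text \<open>Near \<open>p\<close> the frontier is written as a graph in the direction
  \<open>v\<close> of its normal at \<open>p\<close>. The derivative is read off the unit normals,
  which are Lipschitz because of the inner balls.\<close>

lemma C11_loc_frontier_of_inner_balls:
  fixes V :: "'a::euclidean_space set"
  assumes V: "convex V" "closed V" "interior V \<noteq> {}"
    and balls: "\<And>p. p \<in> frontier V \<Longrightarrow> \<exists>s>0. \<exists>\<delta>>0. \<forall>q\<in>frontier V \<inter> ball p \<delta>. \<exists>x. q \<in> cball x s \<and> cball x s \<subseteq> V"
  shows "C11_loc (frontier V)"
  unfolding C11_loc_def
proof
  fix p assume p: "p \<in> frontier V"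
  obtain s \<delta> where s: "0 < s" and \<delta>: "0 < \<delta>"
    and ib: "\<And>q. q \<in> frontier V \<inter> ball p \<delta> \<Longrightarrow> \<exists>x. q \<in> cball x s \<and> cball x s \<subseteq> V"
    using balls[OF p] by blast
  have "\<exists>u. norm u = 1 \<and> (\<forall>z\<in>V. u \<bullet> (z - q) \<le> 0) \<and> cball (q - s *\<^sub>R u) s \<subseteq> V"
    if q: "q \<in> frontier V \<inter> ball p \<delta>" for q
  proof -
    obtain u where u: "norm u = 1" "\<And>z. z \<in> V \<Longrightarrow> u \<bullet> (z - q) \<le> 0"
      using supporting_unit_normal[OF V(1,3)] q by (metis IntD1)
    moreover obtain x where x: "q \<in> cball x s" "cball x s \<subseteq> V" using ib[OF q] by blast
    ultimately have "x = q - s *\<^sub>R u" using inner_ball_centre[OF x(2,1) s u] by blast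
    then show ?thesis using u x by blast
  qed
  then obtain u where u: "\<And>q. q \<in> frontier V \<inter> ball p \<delta> \<Longrightarrow>
      norm (u q) = 1 \<and> (\<forall>z\<in>V. u q \<bullet> (z - q) \<le> 0) \<and> cball (q - s *\<^sub>R u q) s \<subseteq> V"
    by metis
  \<comment> \<open>Since normals are Lipschitz with constant \<open>1 / s\<close>, radius
    \<open>s / 2\<close> keeps them within \<open>1 / 2\<close> of \<open>v\<close>; hence
    \<open>u q \<bullet> v \<ge> 1 / 2\<close> throughout \<open>F\<close>.\<close>
  define r where "r = min \<delta> (s / 2)"
  have r: "0 < r" "r \<le> \<delta>" "r \<le> s / 2" using s \<delta> by (auto simp: r_def)
  define F where "F = frontier V \<inter> ball p r"
  have FV: "q \<in> V" if "q \<in> F" for q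
    using that frontier_subset_closed[OF V(2)] by (auto simp: F_def)
  have un: "norm (u q) = 1" and supp: "\<And>z. z \<in> V \<Longrightarrow> u q \<bullet> (z - q) \<le> 0"
    and cb: "cball (q - s *\<^sub>R u q) s \<subseteq> V" if "q \<in> F" for q
    using u[of q] that r(2) by (auto simp: F_def)
  have lip: "norm (u q\<^sub>1 - u q\<^sub>2) \<le> norm (q\<^sub>1 - q\<^sub>2) / s" if "q\<^sub>1 \<in> F" "q\<^sub>2 \<in> F" for q\<^sub>1 q\<^sub>2
    by (rule unit_normal_lipschitz[of _ _ s _ V]) (use un supp cb that s in auto)
  define v where "v = u p"
  have pF: "p \<in> F" using p r by (simp add: F_def)
  have v1: "norm v = 1" using un[OF pF] by (simp add: v_def)
  then have vv: "v \<bullet> v = 1" by (simp add: dot_square_norm)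
  have uv: "1 / 2 \<le> u q \<bullet> v" if q: "q \<in> F" for q
  proof -
    have "norm (u q - v) \<le> norm (q - p) / s" using lip[OF q pF] by (simp add: v_def)
    also have "\<dots> \<le> r / s"
      using q s by (intro divide_right_mono) (auto simp: F_def dist_norm norm_minus_commute)
    also have "\<dots> \<le> 1 / 2" using r s by (simp add: field_simps)
    finally have "norm (u q - v) \<le> 1 / 2" .
    moreover have "u q \<bullet> v = v \<bullet> v + (u q - v) \<bullet> v" by (simp add: inner_diff_left)
    moreover have "\<bar>(u q - v) \<bullet> v\<bar> \<le> norm (u q - v) * norm v" by (rule Cauchy_Schwarz_ineq2)
    ultimately show ?thesis using v1 vv by simp
  qed
  define P where "P z = z - (v \<bullet> z) *\<^sub>R v" for z
  define D where "D = P ` F"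
  have orth: "{v}\<^sup>\<bottom> = {x. v \<bullet> x = 0}" by (auto simp: orthogonal_comp_def orthogonal_def)
  have Porth: "v \<bullet> P z = 0" for z by (simp add: P_def inner_diff_right vv)
  have dot_le: "t \<le> 0" if "q \<in> F" "u q \<bullet> (t *\<^sub>R v) \<le> 0" for q t
    using that uv[OF that(1)] by (simp add: mult_le_0_iff)
  \<comment> \<open>For two points of \<open>F\<close> on a line parallel to \<open>v\<close>, the
    support inequality at each one forbids the other from lying above it.\<close>
  have inj: "inj_on P F"
  proof (rule inj_onI)
    fix q\<^sub>1 q\<^sub>2 assume q: "q\<^sub>1 \<in> F" "q\<^sub>2 \<in> F" "P q\<^sub>1 = P q\<^sub>2"
    define t where "t = v \<bullet> q\<^sub>2 - v \<bullet> q\<^sub>1"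
    have e: "q\<^sub>2 - q\<^sub>1 = t *\<^sub>R v" "q\<^sub>1 - q\<^sub>2 = (- t) *\<^sub>R v"
      using q(3) by (auto simp: P_def t_def algebra_simps)
    have "t \<le> 0" using dot_le[OF q(1), of t] supp[OF q(1) FV[OF q(2)]] e by simp
    moreover have "- t \<le> 0" using dot_le[OF q(2), of "- t"] supp[OF q(2) FV[OF q(1)]] e by metis
    ultimately show "q\<^sub>1 = q\<^sub>2" using e by simp
  qed
  define Q where "Q = inv_into F P"
  have QF: "Q y \<in> F" and PQ: "P (Q y) = y" if "y \<in> D" for y
    using that unfolding Q_def D_def by (auto simp: inv_into_into f_inv_into_f)
  define f where "f y = v \<bullet> Q y" for y
  have Qf: "Q y = y + f y *\<^sub>R v" if "y \<in> D" for y
    using PQ[OF that] by (simp add: f_def P_def algebra_simps)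
  \<comment> \<open>The support inequality at \<open>Q y\<^sub>1\<close> bounds the rise of
    \<open>f\<close>; the factor 2 is the bound on \<open>1 / (u q \<bullet> v)\<close>.\<close>
  have fl1: "f y\<^sub>2 - f y\<^sub>1 \<le> 2 * norm (y\<^sub>2 - y\<^sub>1)" if y: "y\<^sub>1 \<in> D" "y\<^sub>2 \<in> D" for y\<^sub>1 y\<^sub>2
  proof (cases "f y\<^sub>2 - f y\<^sub>1 \<le> 0")
    case False
    let ?u = "u (Q y\<^sub>1)"
    have "?u \<bullet> (Q y\<^sub>2 - Q y\<^sub>1) \<le> 0" using supp[OF QF FV[OF QF]] y by blast
    then have "(f y\<^sub>2 - f y\<^sub>1) * (?u \<bullet> v) \<le> ?u \<bullet> (y\<^sub>1 - y\<^sub>2)"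
      using y by (simp add: Qf inner_diff_right inner_add_right algebra_simps)
    also have "\<dots> \<le> norm (y\<^sub>2 - y\<^sub>1)"
      using norm_cauchy_schwarz[of ?u "y\<^sub>1 - y\<^sub>2"] un[OF QF[OF y(1)]]
        by (simp add: norm_minus_commute)
    finally have "(f y\<^sub>2 - f y\<^sub>1) * (?u \<bullet> v) \<le> norm (y\<^sub>2 - y\<^sub>1)" .
    moreover have "(f y\<^sub>2 - f y\<^sub>1) * (1 / 2) \<le> (f y\<^sub>2 - f y\<^sub>1) * (?u \<bullet> v)"
      using uv[OF QF[OF y(1)]] False by (intro mult_left_mono) auto
    ultimately show ?thesis by simp
  qed (use norm_ge_zero[of "y\<^sub>2 - y\<^sub>1"] in linarith)
  have Ql: "norm (Q y\<^sub>2 - Q y\<^sub>1) \<le> 3 * norm (y\<^sub>2 - y\<^sub>1)" if y: "y\<^sub>1 \<in> D" "y\<^sub>2 \<in> D" for y\<^sub>1 y\<^sub>2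
  proof -
    have "\<bar>f y\<^sub>2 - f y\<^sub>1\<bar> \<le> 2 * norm (y\<^sub>2 - y\<^sub>1)"
      using fl1[OF y] fl1[OF y(2,1)] by (simp add: norm_minus_commute)
    moreover have "Q y\<^sub>2 - Q y\<^sub>1 = (y\<^sub>2 - y\<^sub>1) + (f y\<^sub>2 - f y\<^sub>1) *\<^sub>R v"
      using y by (simp add: Qf algebra_simps)
    ultimately show ?thesis
      using norm_triangle_ineq[of "y\<^sub>2 - y\<^sub>1" "(f y\<^sub>2 - f y\<^sub>1) *\<^sub>R v"] v1 by simp
  qed
  \<comment> \<open>The gradient solves the tangent plane equation
    \<open>u \<bullet> (h + (a \<bullet> h) *\<^sub>R v) = 0\<close>.\<close>
  define a where "a y = (- 1 / (u (Q y) \<bullet> v)) *\<^sub>R u (Q y)" for y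
  define Df where "Df y = blinfun_inner_left (a y)" for y
  have Df: "blinfun_apply (Df y) h = a y \<bullet> h" for y h
    by (simp add: Df_def blinfun_inner_left.rep_eq inner_commute)
  \<comment> \<open>The support inequalities at both points sandwich the deviation from the tangent
    plane. The constant 18 is 9 from the squared Lipschitz constant 3 of \<open>Q\<close>, times 2
    from the division by \<open>u \<bullet> v\<close>.\<close>
  have quad: "\<bar>f y\<^sub>2 - f y\<^sub>1 - a y\<^sub>1 \<bullet> (y\<^sub>2 - y\<^sub>1)\<bar> \<le> 18 / s * norm (y\<^sub>2 - y\<^sub>1) ^ 2"
    if y: "y\<^sub>1 \<in> D" "y\<^sub>2 \<in> D" for y\<^sub>1 y\<^sub>2
  proof -
    let ?u1 = "u (Q y\<^sub>1)" and ?u2 = "u (Q y\<^sub>2)"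
    have c: "1 / 2 \<le> ?u1 \<bullet> v" using uv QF y by blast
    have "?u1 \<bullet> (Q y\<^sub>2 - Q y\<^sub>1) \<le> 0" "?u2 \<bullet> (Q y\<^sub>1 - Q y\<^sub>2) \<le> 0"
      using supp[OF QF FV[OF QF]] y by blast+
    then have "\<bar>?u1 \<bullet> (Q y\<^sub>2 - Q y\<^sub>1)\<bar> \<le> (?u1 - ?u2) \<bullet> (Q y\<^sub>1 - Q y\<^sub>2)"
      by (simp add: inner_diff)
    also have "\<dots> \<le> norm (?u1 - ?u2) * norm (Q y\<^sub>1 - Q y\<^sub>2)" by (rule norm_cauchy_schwarz)
    also have "\<dots> \<le> (norm (Q y\<^sub>1 - Q y\<^sub>2) / s) * norm (Q y\<^sub>1 - Q y\<^sub>2)"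
      using lip[OF QF QF] y by (intro mult_right_mono) auto
    also have "\<dots> = norm (Q y\<^sub>1 - Q y\<^sub>2) ^ 2 / s" by (simp add: power2_eq_square)
    also have "\<dots> \<le> (3 * norm (y\<^sub>1 - y\<^sub>2)) ^ 2 / s"
      using Ql[OF y(2,1)] s by (intro divide_right_mono power_mono) auto
    finally have b: "\<bar>?u1 \<bullet> (Q y\<^sub>2 - Q y\<^sub>1)\<bar> \<le> 9 / s * norm (y\<^sub>2 - y\<^sub>1) ^ 2"
      by (simp add: power_mult_distrib norm_minus_commute)
    have "f y\<^sub>2 - f y\<^sub>1 - a y\<^sub>1 \<bullet> (y\<^sub>2 - y\<^sub>1) = (?u1 \<bullet> (Q y\<^sub>2 - Q y\<^sub>1)) / (?u1 \<bullet> v)"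
      using c y by (simp add: a_def Qf inner_diff_right inner_add_right field_simps)
    then have "\<bar>f y\<^sub>2 - f y\<^sub>1 - a y\<^sub>1 \<bullet> (y\<^sub>2 - y\<^sub>1)\<bar> = \<bar>?u1 \<bullet> (Q y\<^sub>2 - Q y\<^sub>1)\<bar> / (?u1 \<bullet> v)"
      using c by simp
    also have "\<dots> \<le> \<bar>?u1 \<bullet> (Q y\<^sub>2 - Q y\<^sub>1)\<bar> / (1 / 2)"
      using c by (intro divide_left_mono) auto
    also have "\<dots> \<le> 18 / s * norm (y\<^sub>2 - y\<^sub>1) ^ 2" using b by simp
    finally show ?thesis .
  qed
  \<comment> \<open>The difference is split into a change of the normal and a change of the
    denominator, costing 2 and 4 times the change of the normal, itself at most \<open>3 / s\<close>
    times the distance.\<close>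
  have alip: "norm (a y\<^sub>1 - a y\<^sub>2) \<le> 18 / s * norm (y\<^sub>1 - y\<^sub>2)"
    if y: "y\<^sub>1 \<in> D" "y\<^sub>2 \<in> D" for y\<^sub>1 y\<^sub>2
  proof -
    let ?u1 = "u (Q y\<^sub>1)" and ?u2 = "u (Q y\<^sub>2)"
    let ?c1 = "?u1 \<bullet> v" and ?c2 = "?u2 \<bullet> v"
    have c: "1 / 2 \<le> ?c1" "1 / 2 \<le> ?c2" using uv QF y by blast+
    have inv2: "\<bar>1 / x\<bar> \<le> 2" if "1 / 2 \<le> x" for x :: real
      using that by (simp add: divide_le_eq)
    have n: "norm (?u1 - ?u2) \<le> 3 / s * norm (y\<^sub>1 - y\<^sub>2)"
    proof -
      have "norm (?u1 - ?u2) \<le> norm (Q y\<^sub>1 - Q y\<^sub>2) / s" using lip[OF QF QF] y by blast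
      also have "\<dots> \<le> 3 * norm (y\<^sub>1 - y\<^sub>2) / s"
        using Ql[OF y(2,1)] s by (intro divide_right_mono) auto
      finally show ?thesis by simp
    qed
    have "a y\<^sub>1 - a y\<^sub>2 = (1 / ?c1) *\<^sub>R (?u2 - ?u1) + ((?c1 - ?c2) * (1 / ?c1) * (1 / ?c2)) *\<^sub>R ?u2"
    proof -
      have "(?c1 - ?c2) * (1 / ?c1) * (1 / ?c2) = 1 / ?c2 - 1 / ?c1"
        using c by (simp add: field_simps)
      then show ?thesis by (simp only:) (simp add: a_def scaleR_diff_left scaleR_diff_right)
    qed
    then have "norm (a y\<^sub>1 - a y\<^sub>2) \<le> norm ((1 / ?c1) *\<^sub>R (?u2 - ?u1)) + norm (((?c1 - ?c2) * (1 / ?c1) * (1 / ?c2)) *\<^sub>R ?u2)"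
      by (elim ssubst) (rule norm_triangle_ineq)
    also have "norm ((1 / ?c1) *\<^sub>R (?u2 - ?u1)) \<le> 2 * norm (?u1 - ?u2)"
    proof -
      have "\<bar>1 / ?c1\<bar> \<le> 2" using inv2[OF c(1)] .
      then show ?thesis by (simp add: norm_minus_commute mult_right_mono del: abs_divide)
    qed
    also have "norm (((?c1 - ?c2) * (1 / ?c1) * (1 / ?c2)) *\<^sub>R ?u2) \<le> norm (?u1 - ?u2) * 2 * 2"
    proof -
      have "\<bar>?c1 - ?c2\<bar> \<le> norm (?u1 - ?u2)"
        using Cauchy_Schwarz_ineq2[of "?u1 - ?u2" v] v1 by (simp add: inner_diff_left)
      moreover have "\<bar>1 / ?c1\<bar> \<le> 2" "\<bar>1 / ?c2\<bar> \<le> 2" using inv2 c by blast+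
      ultimately have "\<bar>?c1 - ?c2\<bar> * \<bar>1 / ?c1\<bar> * \<bar>1 / ?c2\<bar> \<le> norm (?u1 - ?u2) * 2 * 2"
        by (intro mult_mono) auto
      then show ?thesis using un[OF QF[OF y(2)]] by (simp add: abs_mult)
    qed
    finally show ?thesis using n by simp
  qed
  \<comment> \<open>Just below \<open>q\<close> along \<open>v\<close> lies a ball inside
    \<open>V\<close>, just above it a ball outside. Hence lines parallel to \<open>v\<close> over
    nearby base points also cross the frontier, and do so within \<open>F\<close>.\<close>
  have "openin (top_of_set ({v}\<^sup>\<bottom>)) D"
    unfolding openin_euclidean_subtopology_iff
  proof (intro conjI ballI)
    show "D \<subseteq> {v}\<^sup>\<bottom>" using Porth by (auto simp: D_def orth)
    fix y assume y: "y \<in> D"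
    define q where "q = Q y"
    have q: "q \<in> F" "P q = y" using QF PQ y by (auto simp: q_def)
    have "open (ball p r)" "q \<in> ball p r" using q by (auto simp: F_def)
    then obtain \<eta> where \<eta>: "0 < \<eta>" "ball q \<eta> \<subseteq> ball p r" using open_contains_ball by blast
    define \<tau> where "\<tau> = min (\<eta> / 2) (s / 2)"
    have \<tau>: "0 < \<tau>" "\<tau> \<le> \<eta> / 2" "\<tau> < s" using \<eta> s by (auto simp: \<tau>_def)
    \<comment> \<open>This uses \<open>\<tau> < s \<le> 2 * s * (u q \<bullet> v)\<close>: the
      direction \<open>- v\<close> enters the ball touching at \<open>q\<close>.\<close>
    have "q - \<tau> *\<^sub>R v \<in> ball (q - s *\<^sub>R u q) s"
    proof -
      have "norm (s *\<^sub>R u q - \<tau> *\<^sub>R v) ^ 2 = s ^ 2 * (u q \<bullet> u q) - 2 * \<tau> * s * (u q \<bullet> v) + \<tau> ^ 2 * (v \<bullet> v)"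
        unfolding power2_norm_eq_inner
        by (simp add: inner_diff inner_commute algebra_simps power2_eq_square)
      also have "\<dots> = s ^ 2 - \<tau> * (2 * s * (u q \<bullet> v) - \<tau>)"
        using un[OF q(1)] vv by (simp add: dot_square_norm algebra_simps power2_eq_square)
      also have "\<dots> < s ^ 2"
      proof -
        have "s * 1 \<le> s * (2 * (u q \<bullet> v))" using uv[OF q(1)] s by (intro mult_left_mono) auto
        then have "0 < 2 * s * (u q \<bullet> v) - \<tau>" using \<tau> by linarith
        from mult_pos_pos[OF \<tau>(1) this] show ?thesis by linarith
      qed
      finally have "norm (s *\<^sub>R u q - \<tau> *\<^sub>R v) < s" using s by (simp add: power2_less_imp_less)
      then show ?thesis by (simp add: dist_norm norm_minus_commute)
    qed
    moreover have "ball (q - s *\<^sub>R u q) s \<subseteq> V" using cb[OF q(1)] ball_subset_cball by blast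
    ultimately obtain e1 where e1: "0 < e1" "ball (q - \<tau> *\<^sub>R v) e1 \<subseteq> V"
      by (meson open_ball open_contains_ball order_trans)
    have "q + \<tau> *\<^sub>R v \<notin> V"
    proof
      assume "q + \<tau> *\<^sub>R v \<in> V"
      then have "u q \<bullet> (\<tau> *\<^sub>R v) \<le> 0" using supp[OF q(1)] by fastforce
      then show False using dot_le[OF q(1)] \<tau>(1) by fastforce
    qed
    moreover have "open (- V)" using V(2) by auto
    ultimately obtain e2 where e2: "0 < e2" "ball (q + \<tau> *\<^sub>R v) e2 \<subseteq> - V"
      by (meson ComplI open_contains_ball)
    define e where "e = min (\<eta> / 2) (min e1 e2)"
    have e: "0 < e" "e \<le> \<eta> / 2" "e \<le> e1" "e \<le> e2" using \<eta> e1 e2 by (auto simp: e_def)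
    have "y' \<in> D" if y': "y' \<in> {v}\<^sup>\<bottom>" "dist y' y < e" for y'
    proof -
      define z where "z = q + (y' - y)"
      have "z - \<tau> *\<^sub>R v \<in> ball (q - \<tau> *\<^sub>R v) e1" "z + \<tau> *\<^sub>R v \<in> ball (q + \<tau> *\<^sub>R v) e2"
        using y'(2) e by (auto simp: z_def dist_norm norm_minus_commute)
      then have "z + (- \<tau>) *\<^sub>R v \<in> V" "z + \<tau> *\<^sub>R v \<notin> V"
        using e1(2) e2(2) by (auto simp only: scaleR_minus_left diff_conv_add_uminus[symmetric])
      then obtain w where w: "min (- \<tau>) \<tau> \<le> w" "w \<le> max (- \<tau>) \<tau>" "z + w *\<^sub>R v \<in> frontier V"
        using frontier_on_segment by metis
      have dw: "norm ((y' - y) + w *\<^sub>R v) < e + \<tau>"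
        using y'(2) w \<tau> v1 norm_triangle_ineq[of "y' - y" "w *\<^sub>R v"] by (auto simp: dist_norm)
      have "z + w *\<^sub>R v \<in> ball q \<eta>"
      proof -
        have "dist (z + w *\<^sub>R v) q = norm ((y' - y) + w *\<^sub>R v)"
          by (simp add: z_def dist_norm)
        then show ?thesis using dw e \<tau> by (simp add: dist_commute)
      qed
      then have "z + w *\<^sub>R v \<in> F" using w(3) \<eta>(2) by (auto simp: F_def)
      moreover have "P (z + w *\<^sub>R v) = y'"
      proof -
        have "v \<bullet> y = 0" using Porth[of q] q(2) by simp
        moreover have "v \<bullet> y' = 0" using y'(1) by (simp add: orth)
        ultimately have "P (z + w *\<^sub>R v) = P q + (y' - y)"
          by (simp add: z_def P_def inner_add_right inner_diff_right vv algebra_simps)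
        then show ?thesis using q(2) by simp
      qed
      ultimately show ?thesis unfolding D_def by blast
    qed
    then show "\<exists>e>0. \<forall>x'\<in>{v}\<^sup>\<bottom>. dist x' y < e \<longrightarrow> x' \<in> D" using e(1) by blast
  qed
  moreover have "(f has_derivative blinfun_apply (Df y)) (at y within D)" if y: "y \<in> D" for y
    unfolding has_derivative_within_alt
  proof (intro conjI allI impI)
    show "bounded_linear (blinfun_apply (Df y))" by (rule blinfun.bounded_linear_right)
    fix e :: real assume e: "0 < e"
    show "\<exists>d>0. \<forall>y'\<in>D. norm (y' - y) < d \<longrightarrow> norm (f y' - f y - blinfun_apply (Df y) (y' - y)) \<le> e * norm (y' - y)"
    proof (intro exI[of _ "e * s / 18"] conjI ballI impI)
      show "0 < e * s / 18" using e s by simp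
      fix y' assume y': "y' \<in> D" "norm (y' - y) < e * s / 18"
      have "\<bar>f y' - f y - a y \<bullet> (y' - y)\<bar> \<le> (18 / s * norm (y' - y)) * norm (y' - y)"
        using quad[OF y y'(1)] by (simp add: power2_eq_square)
      also have "\<dots> \<le> e * norm (y' - y)"
        using y'(2) s by (intro mult_right_mono) (auto simp: field_simps)
      finally show "norm (f y' - f y - blinfun_apply (Df y) (y' - y)) \<le> e * norm (y' - y)"
        by (simp add: Df)
    qed
  qed
  moreover have "(18 / s)-lipschitz_on D Df"
  proof (rule lipschitz_onI)
    fix y\<^sub>1 y\<^sub>2 assume y: "y\<^sub>1 \<in> D" "y\<^sub>2 \<in> D"
    have "norm (Df y\<^sub>1 - Df y\<^sub>2) \<le> norm (a y\<^sub>1 - a y\<^sub>2)"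
     
        by (rule norm_blinfun_bound) (auto simp: blinfun.diff_left Df inner_diff_left[symmetric] Cauchy_Schwarz_ineq2)
    then show "dist (Df y\<^sub>1) (Df y\<^sub>2) \<le> 18 / s * dist y\<^sub>1 y\<^sub>2"
      using alip[OF y] by (simp add: dist_norm)
  qed (use s in simp)
  ultimately have "C11_on ({v}\<^sup>\<bottom>) D f" unfolding C11_on_def by blast
  moreover have "frontier V \<inter> ball p r = (\<lambda>y. y + f y *\<^sub>R v) ` D"
  proof -
    have "(\<lambda>y. y + f y *\<^sub>R v) ` D = Q ` D" using Qf by (simp add: image_def)
    also have "\<dots> = F" unfolding Q_def D_def using inj by (auto simp: image_image)
    finally show ?thesis by (simp add: F_def)
  qed
  ultimately show "\<exists>U v D f. open U \<and> p \<in> U \<and> norm v = 1 \<and> C11_on ({v}\<^sup>\<bottom>) D f \<and>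
      frontier V \<inter> U = (\<lambda>y. y + f y *\<^sub>R v) ` D"
    using v1 r(1) by (metis centre_in_ball open_ball)
qed

section \<open>Recession directions\<close>

text \<open>The point is a limit of combinations of \<open>x\<close> with points of the given ray at
  parameter \<open>s * (n + 1)\<close>, taken with weight \<open>1 / (n + 1)\<close>.\<close>

lemma recession_direction_from_point:
  fixes W :: "'a::real_normed_vector set"
  assumes "closed W" "convex W" "\<And>s. 0 \<le> s \<Longrightarrow> a + s *\<^sub>R v \<in> W" "x \<in> W" "0 \<le> s"
  shows "x + s *\<^sub>R v \<in> W"
proof (rule closed_sequentially[OF assms(1)])
  let ?t = "\<lambda>n. inverse (real (Suc n))"
  show "(1 - ?t n) *\<^sub>R x + ?t n *\<^sub>R (a + (s * real (Suc n)) *\<^sub>R v) \<in> W" for n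
    using assms(3)[of "s * real (Suc n)"] assms(4,5)
    by (intro convexD_alt[OF assms(2)]) (auto simp: divide_simps)
  have "(1 - ?t n) *\<^sub>R x + ?t n *\<^sub>R (a + (s * real (Suc n)) *\<^sub>R v) = (1 - ?t n) *\<^sub>R x + ?t n *\<^sub>R a + s *\<^sub>R v" for n
    by (simp add: scaleR_add_right mult.commute[of s] del: of_nat_Suc flip: mult.assoc)
  then have "(\<lambda>n. (1 - ?t n) *\<^sub>R x + ?t n *\<^sub>R (a + (s * real (Suc n)) *\<^sub>R v)) = (\<lambda>n. (1 - ?t n) *\<^sub>R x + ?t n *\<^sub>R a + s *\<^sub>R v)"
    by (rule ext)
  moreover have "(\<lambda>n. (1 - ?t n) *\<^sub>R x + ?t n *\<^sub>R a + s *\<^sub>R v) \<longlonglongrightarrow> (1 - 0) *\<^sub>R x + 0 *\<^sub>R a + s *\<^sub>R v"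
    by (intro tendsto_intros LIMSEQ_inverse_real_of_nat)
  ultimately show "(\<lambda>n. (1 - ?t n) *\<^sub>R x + ?t n *\<^sub>R (a + (s * real (Suc n)) *\<^sub>R v)) \<longlonglongrightarrow> x + s *\<^sub>R v"
    by (simp only:) simp
qed

text \<open>A limit of unit directions from \<open>a\<close> to points escaping to infinity is the
  direction of the ray.\<close>

lemma unbounded_convex_contains_ray:
  fixes K :: "'a::euclidean_space set"
  assumes "closed K" "convex K" "a \<in> K" "\<not> bounded K"
  obtains v where "norm v = 1" "\<And>s. 0 \<le> s \<Longrightarrow> a + s *\<^sub>R v \<in> K"
proof -
  have "\<exists>y\<in>K. real n < norm (y - a)" for n
  proof (rule ccontr)
    assume "\<not> ?thesis"
    then have "K \<subseteq> cball a (real n)" by (auto simp: dist_norm norm_minus_commute not_less)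
    then show False using assms(4) bounded_subset bounded_cball by blast
  qed
  then obtain y where y: "\<And>n. y n \<in> K" "\<And>n. real n < norm (y n - a)" by metis
  define d where "d n = (y n - a) /\<^sub>R norm (y n - a)" for n
  have pos: "0 < norm (y n - a)" for n using y(2)[of n] by (meson le_less_trans of_nat_0_le_iff)
  then have "d n \<in> sphere 0 1" for n by (simp add: d_def)
  then obtain v r where v: "v \<in> sphere 0 1" and r: "strict_mono r" "(d \<circ> r) \<longlonglongrightarrow> v"
    using compact_sphere unfolding compact_def by metis
  have "a + s *\<^sub>R v \<in> K" if s: "0 \<le> s" for s
  proof (rule Lim_in_closed_set[OF assms(1)])
    show "((\<lambda>n. a + s *\<^sub>R (d \<circ> r) n) \<longlongrightarrow> a + s *\<^sub>R v) sequentially"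
      by (intro tendsto_intros r)
    have "\<forall>\<^sub>F n in sequentially. s \<le> real n"
      by (metis eventually_at_top_linorder real_arch_simple order_trans of_nat_le_iff)
    then show "\<forall>\<^sub>F n in sequentially. a + s *\<^sub>R (d \<circ> r) n \<in> K"
    proof eventually_elim
      case (elim n)
      have "real n \<le> real (r n)" using seq_suble[OF r(1)] by simp
      then have "s \<le> norm (y (r n) - a)" using elim y(2)[of "r n"] by linarith
      then have "(1 - s / norm (y (r n) - a)) *\<^sub>R a + (s / norm (y (r n) - a)) *\<^sub>R y (r n) \<in> K"
        using s pos[of "r n"] y(1) assms(3) by (intro convexD_alt[OF assms(2)]) auto
      then show ?case by (simp add: d_def algebra_simps divide_inverse)
    qed
  qed simp
  then show ?thesis using that v by auto
qed

text \<open>Without lines the recession cone \<open>C\<close> is pointed, so some functional is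
  positive on its unit vectors. An unbounded slice would contain a ray, along which that functional
  is bounded although the direction lies in \<open>C\<close>.\<close>

lemma line_free_compact_slices:
  fixes W :: "'a::euclidean_space set"
  assumes W: "closed W" "convex W" "W \<noteq> {}"
    and no_line: "\<And>v x. v \<noteq> 0 \<Longrightarrow> x \<in> W \<Longrightarrow> \<exists>s. x + s *\<^sub>R v \<notin> W"
  obtains e where "norm e = 1" "\<And>t. compact (W \<inter> {x. e \<bullet> x \<le> t})"
proof -
  define C where "C = {v. \<forall>x\<in>W. \<forall>s\<ge>0. x + s *\<^sub>R v \<in> W}"
  have Cadd: "v + w \<in> C" if "v \<in> C" "w \<in> C" for v w
    using that by (force simp: C_def scaleR_add_right add.assoc[symmetric])
  have Cscale: "c *\<^sub>R v \<in> C" if "v \<in> C" "0 \<le> c" for v c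
    using that by (auto simp: C_def)
  have C0: "0 \<in> C" by (simp add: C_def)
  have Csum: "(\<Sum>i\<in>I. f i) \<in> C" if "\<And>i. i \<in> I \<Longrightarrow> f i \<in> C" for I and f :: "'a \<Rightarrow> 'a"
    using that by (induction I rule: infinite_finite_induct) (auto intro: C0 Cadd)
  have pointed: "v = 0" if "v \<in> C" "- v \<in> C" for v
  proof (rule ccontr)
    assume "v \<noteq> 0"
    obtain x where x: "x \<in> W" using W(3) by blast
    then obtain s where s: "x + s *\<^sub>R v \<notin> W" using no_line[OF \<open>v \<noteq> 0\<close>] by blast
    show False
    proof (cases "0 \<le> s")
      case True then show False using s that(1) x by (auto simp: C_def)
    next
      case False
      then have "x + (- s) *\<^sub>R (- v) \<in> W"
        using that(2) x by (simp add: C_def del: scaleR_minus_left scaleR_minus_right)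
      then show False using s by simp
    qed
  qed
  have "closed C"
  proof -
    have "C = (\<Inter>x\<in>W. \<Inter>s\<in>{0..}. (\<lambda>v. x + s *\<^sub>R v) -` W)" by (auto simp: C_def)
    moreover have "closed ((\<lambda>v. x + s *\<^sub>R v) -` W)" for x s
      by (intro closed_vimage W continuous_intros)
    ultimately show ?thesis by (simp only:) (auto intro!: closed_INT)
  qed
  then have "compact (C \<inter> sphere 0 1)" by (intro closed_Int_compact compact_sphere)
  then have cc: "compact (convex hull (C \<inter> sphere 0 1))" by (rule compact_convex_hull)
  \<comment> \<open>If 0 were a convex combination of unit vectors of \<open>C\<close>, one term
    with nonzero weight would have its negative in \<open>C\<close> as well.\<close>
  have "0 \<notin> convex hull (C \<inter> sphere 0 1)"
  proof
    assume "0 \<in> convex hull (C \<inter> sphere 0 1)"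
    then obtain I u where I: "finite I" "I \<subseteq> C \<inter> sphere 0 1" "\<forall>x\<in>I. 0 \<le> u x" "sum u I = 1"
        and z: "(\<Sum>x\<in>I. u x *\<^sub>R x) = 0"
      unfolding convex_hull_explicit by auto
    obtain w where w: "w \<in> I" "u w \<noteq> 0" using I(4) by (metis sum.neutral zero_neq_one)
    have "(\<Sum>x\<in>I - {w}. u x *\<^sub>R x) \<in> C" using I by (intro Csum Cscale) auto
    moreover have "(\<Sum>x\<in>I - {w}. u x *\<^sub>R x) = - (u w *\<^sub>R w)"
      using z sum.remove[OF I(1) w(1), of "\<lambda>x. u x *\<^sub>R x"] by (simp add: add_eq_0_iff)
    moreover have "u w *\<^sub>R w \<in> C" using I w by (intro Cscale) auto
    ultimately have "u w *\<^sub>R w = 0" using pointed by metis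
    then show False using w I by auto
  qed
  then obtain a b where ab: "a \<noteq> 0" "0 < b" "\<And>x. x \<in> convex hull (C \<inter> sphere 0 1) \<Longrightarrow> b < a \<bullet> x"
    using separating_hyperplane_closed_0[OF convex_convex_hull compact_imp_closed[OF cc]] by blast
  define e where "e = a /\<^sub>R norm a"
  have "compact (W \<inter> {x. e \<bullet> x \<le> t})" for t
  proof -
    let ?K = "W \<inter> {x. e \<bullet> x \<le> t}"
    have K: "closed ?K" "convex ?K"
      using W by (auto intro!: closed_Int convex_Int closed_halfspace_le convex_halfspace_le)
    have "bounded ?K"
    proof (rule ccontr)
      assume unb: "\<not> bounded ?K"
      then obtain x where x: "x \<in> ?K" by (metis bounded_empty ex_in_conv)
      obtain v where v: "norm v = 1" "\<And>s. 0 \<le> s \<Longrightarrow> x + s *\<^sub>R v \<in> ?K"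
        using unbounded_convex_contains_ray[OF K x unb] by blast
      have "v \<in> C"
        unfolding C_def using recession_direction_from_point[OF W(1,2), of x v] v(2) by blast
      then have "b < a \<bullet> v" using v(1) by (intro ab(3) hull_inc) auto
      then have "0 < e \<bullet> v" using ab by (simp add: e_def)
      let ?s = "(\<bar>t - e \<bullet> x\<bar> + 1) / (e \<bullet> v)"
      have "x + ?s *\<^sub>R v \<in> ?K" using \<open>0 < e \<bullet> v\<close> by (intro v(2)) auto
      then have "e \<bullet> x + (\<bar>t - e \<bullet> x\<bar> + 1) \<le> t"
        using \<open>0 < e \<bullet> v\<close> by (simp add: inner_add_right)
      then show False by linarith
    qed
    then show ?thesis using K by (simp add: compact_eq_bounded_closed)
  qed
  then show ?thesis using that[of e] ab(1) by (simp add: e_def)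
qed

text \<open>The ball is contracted toward \<open>q\<close> with ratio \<open>s / r\<close>.\<close>

lemma cball_smaller_radius:
  fixes x q :: "'a::real_normed_vector"
  assumes "q \<in> cball x r" "0 < s" "s \<le> r"
  obtains x' where "q \<in> cball x' s" "cball x' s \<subseteq> cball x r"
proof -
  let ?x = "q + (s / r) *\<^sub>R (x - q)"
  have d: "norm (x - q) \<le> r" using assms(1) by (simp add: dist_norm)
  have t: "0 < s / r" "s / r \<le> 1" using assms by auto
  have "s / r * norm (x - q) \<le> s / r * r" using d t by (intro mult_left_mono) auto
  then have "q \<in> cball ?x s" using assms t by (simp add: dist_norm)
  moreover have le: "dist x ?x + s \<le> r"
  proof -
    have "x - ?x = (1 - s / r) *\<^sub>R (x - q)" by (simp add: algebra_simps)
    then have "dist x ?x = (1 - s / r) * norm (x - q)" using t by (simp add: dist_norm)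
    also have "\<dots> \<le> (1 - s / r) * r" using d t by (intro mult_left_mono) auto
    finally show ?thesis using assms by (simp add: algebra_simps)
  qed
  have "cball ?x s \<subseteq> cball x r"
  proof (intro subsetI)
    fix z assume "z \<in> cball ?x s"
    then show "z \<in> cball x r"
      using le dist_triangle[of x z ?x] by simp
  qed
  ultimately show ?thesis using that by blast
qed

section \<open>Approximation from inside\<close>

lemma C11_approximation_from_inside:
  fixes W :: "'a::euclidean_space set"
  assumes W: "closed W" "convex W" "interior W \<noteq> {}"
    and no_line: "\<And>v x. v \<noteq> 0 \<Longrightarrow> x \<in> W \<Longrightarrow> \<exists>s. x + s *\<^sub>R v \<notin> W"
    and \<epsilon>: "0 < \<epsilon>"
  obtains V where "closed V" "convex V" "interior V \<noteq> {}" "C11_loc (frontier V)"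
    "hausdorff_measure (DIM('a) - 1) (sym_diff (frontier W) (frontier V)) < ennreal \<epsilon>"
proof -
  let ?H = "hausdorff_measure (DIM('a) - 1)"
  have W0: "W \<noteq> {}" using W(3) interior_subset by blast
  obtain e where e: "norm e = 1" "\<And>t. compact (W \<inter> {x. e \<bullet> x \<le> t})"
    using line_free_compact_slices[OF W(1,2) W0 no_line] by blast
  obtain x0 where x0: "x0 \<in> W" "\<And>x. x \<in> W \<Longrightarrow> e \<bullet> x0 \<le> e \<bullet> x"
  proof -
    obtain a where a: "a \<in> W" using W0 by blast
    then have "W \<inter> {x. e \<bullet> x \<le> e \<bullet> a} \<noteq> {}" by blast
    moreover have "continuous_on (W \<inter> {x. e \<bullet> x \<le> e \<bullet> a}) (\<lambda>x. e \<bullet> x)" by (intro continuous_intros)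
    ultimately obtain x0 where "x0 \<in> W" "e \<bullet> x0 \<le> e \<bullet> a" "\<And>x. x \<in> W \<Longrightarrow> e \<bullet> x \<le> e \<bullet> a \<Longrightarrow> e \<bullet> x0 \<le> e \<bullet> x"
      using continuous_attains_inf[OF e(2)] by fastforce
    then show ?thesis using that by (meson linear order_trans)
  qed
  \<comment> \<open>Height above a lowest point of \<open>W\<close>: affine, 1-Lipschitz and
    nonnegative on \<open>W\<close>.\<close>
  define h where "h x = e \<bullet> x - e \<bullet> x0" for x
  have h0: "0 \<le> h x" if "x \<in> W" for x using x0(2)[OF that] by (simp add: h_def)
  have hlip: "\<bar>h x - h y\<bar> \<le> dist x y" for x y
    using Cauchy_Schwarz_ineq2[of e "x - y"] e(1) by (simp add: h_def dist_norm inner_diff_right)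
  obtain z where z: "z \<in> interior W" using W(3) by blast
  then obtain s0' where s0': "0 < s0'" "cball z s0' \<subseteq> W" using mem_interior_cball by blast
  define s0 where "s0 = min s0' 1"
  have s0: "0 < s0" "s0 \<le> 1" "cball z s0 \<subseteq> W" using s0' by (auto simp: s0_def)
  \<comment> \<open>This puts the interior point \<open>z\<close> strictly inside every slice,
    already for \<open>k = 0\<close>.\<close>
  define M where "M = h z + 1"
  have hz: "0 \<le> h z" using z interior_subset h0 by blast
  define Wk where "Wk k = W \<inter> {x. h x \<le> real k + M}" for k
  have Wk_eq: "Wk k = W \<inter> {x. e \<bullet> x \<le> real k + M + e \<bullet> x0}" for k
    by (auto simp: Wk_def h_def)
  have Wk: "compact (Wk k)" "convex (Wk k)" "interior (Wk k) \<noteq> {}" for k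
  proof -
    show "compact (Wk k)" unfolding Wk_eq by (rule e(2))
    show "convex (Wk k)" unfolding Wk_eq by (intro convex_Int W convex_halfspace_le)
    have "open {x. h x < real k + M}"
      unfolding h_def by (intro open_Collect_less continuous_intros)
    then have "interior W \<inter> {x. h x < real k + M} \<subseteq> interior (Wk k)"
      using interior_subset by (intro interior_maximal) (auto simp: Wk_def less_imp_le)
    moreover have "z \<in> interior W \<inter> {x. h x < real k + M}" using z by (simp add: M_def)
    ultimately show "interior (Wk k) \<noteq> {}" by blast
  qed
  \<comment> \<open>The errors add up to \<open>\<epsilon> / 4\<close>. The part of the new frontier
    outside the old one gets the same bound, so the total stays at
    \<open>\<epsilon> / 2\<close>.\<close>
  have "\<exists>r. 0 < r \<and> r \<le> s0 \<and>
      ?H (frontier (Wk k) - inner_ball_points r (Wk k)) < ennreal (\<epsilon> / 4 * (1/2) ^ Suc k)" for k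
  proof -
    have "\<forall>\<^sub>F r in at_right 0. ?H (frontier (Wk k) - inner_ball_points r (Wk k)) < ennreal (\<epsilon> / 4 * (1/2) ^ Suc k)"
      using Wk[of k] \<epsilon> by (intro eventually_inner_ball_points) auto
    moreover have "\<forall>\<^sub>F r in at_right 0. r \<in> {0<..<s0}"
      using s0 by (intro eventually_at_right_real)
    ultimately have "\<forall>\<^sub>F r in at_right 0. ?H (frontier (Wk k) - inner_ball_points r (Wk k)) < ennreal (\<epsilon> / 4 * (1/2) ^ Suc k)
        \<and> r \<in> {0<..<s0}" by (rule eventually_conj)
    from eventually_happens'[OF trivial_limit_at_right_real this] show ?thesis
      by (auto intro: less_imp_le)
  qed
  then obtain \<rho> where \<rho>: "\<And>k. 0 < \<rho> k" "\<And>k. \<rho> k \<le> s0"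
    "\<And>k. ?H (frontier (Wk k) - inner_ball_points (\<rho> k) (Wk k)) < ennreal (\<epsilon> / 4 * (1/2) ^ Suc k)"
    by metis
  \<comment> \<open>The minimum reaches up to index \<open>k + 1\<close> because a ball touching at
    height about \<open>j\<close> has its centre above height \<open>j - 2\<close>: for
    \<open>j \<ge> k + 2\<close> the constraint with index \<open>k\<close> is then void. For
    smaller \<open>j\<close> the divisor \<open>k + 2\<close> exceeds
    \<open>k - h x\<close>.\<close>
  define a where "a k = Min (\<rho> ` {..Suc k}) / real (k + 2)" for k
  have a_pos: "0 < a k" for k using \<rho>(1) by (auto simp: a_def)
  have a_le: "a k * real (k + 2) \<le> \<rho> j" if "j \<le> Suc k" for j k
    using that by (auto simp: a_def)
  \<comment> \<open>The radius is bounded below by a supremum of affine functions of \<open>h x\<close>, so \<open>G\<close> is convex. The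
    slopes \<open>a k\<close> are small enough for \<open>G\<close> to contain the balls of radius \<open>\<rho> j\<close> touching \<open>Wk j\<close>.\<close>
  define G where "G = {(x, r). cball x r \<subseteq> W \<and> 0 \<le> r \<and> r \<le> 1 \<and> (\<forall>k. a k * (real k - h x) \<le> r)}"
  define V where "V = {y. \<exists>x r. (x, r) \<in> G \<and> y \<in> cball x r}"
  have G_V: "cball x r \<subseteq> V" if "(x, r) \<in> G" for x r using that unfolding V_def by blast
  have VW: "V \<subseteq> W" unfolding V_def G_def by blast
  have "convex V"
  proof (rule convexI)
    fix p q and u v :: real assume p: "p \<in> V" and q: "q \<in> V" and uv: "0 \<le> u" "0 \<le> v" "u + v = 1"
    obtain x r y s where x: "(x, r) \<in> G" "p \<in> cball x r" and y: "(y, s) \<in> G" "q \<in> cball y s"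
      using p q by (auto simp: V_def)
    have "(u *\<^sub>R x + v *\<^sub>R y, u * r + v * s) \<in> G"
      unfolding G_def
    proof (clarify, intro conjI allI)
      show "cball (u *\<^sub>R x + v *\<^sub>R y) (u * r + v * s) \<subseteq> W"
        using x y uv by (intro cball_subset_convex_combination W) (auto simp: G_def)
      show "0 \<le> u * r + v * s" using x y uv by (auto simp: G_def)
      show "u * r + v * s \<le> 1" using x y uv by (intro convex_bound_le) (auto simp: G_def)
      fix k
      have v: "v = 1 - u" using uv(3) by simp
      have "a k * (real k - h (u *\<^sub>R x + v *\<^sub>R y)) = u * (a k * (real k - h x)) + v * (a k * (real k - h y))"
        unfolding v by (simp add: h_def inner_add_right algebra_simps)
      also have "\<dots> \<le> u * r + v * s"
        using x y uv by (auto simp: G_def intro!: add_mono mult_left_mono)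
      finally show "a k * (real k - h (u *\<^sub>R x + v *\<^sub>R y)) \<le> u * r + v * s" .
    qed
    moreover have "u *\<^sub>R p + v *\<^sub>R q \<in> cball (u *\<^sub>R x + v *\<^sub>R y) (u * r + v * s)"
    proof -
      have "(u *\<^sub>R x + v *\<^sub>R y) - (u *\<^sub>R p + v *\<^sub>R q) = u *\<^sub>R (x - p) + v *\<^sub>R (y - q)"
        by (simp add: algebra_simps)
      moreover have "norm (u *\<^sub>R (x - p) + v *\<^sub>R (y - q)) \<le> u * r + v * s"
        using x y uv by (intro norm_triangle_mono) (auto simp: dist_norm intro!: mult_left_mono)
      ultimately show ?thesis by (simp add: dist_norm)
    qed
    ultimately show "u *\<^sub>R p + v *\<^sub>R q \<in> V" using G_V by blast
  qed
  \<comment> \<open>Radii are at most 1, so the balls containing a convergent sequence have bounded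
    centres. A subsequence of centres and radii converges, and the limit pair stays in
    \<open>G\<close>.\<close>
  have "closed V"
    unfolding closed_sequential_limits
  proof (intro allI impI)
    fix q l assume "(\<forall>n. q n \<in> V) \<and> q \<longlonglongrightarrow> l"
    then have q: "\<And>n. q n \<in> V" "q \<longlonglongrightarrow> l" by auto
    have "\<exists>x r. (x, r) \<in> G \<and> q n \<in> cball x r" for n using q(1)[of n] by (simp add: V_def)
    then obtain x r where xr: "\<And>n. (x n, r n) \<in> G" "\<And>n. q n \<in> cball (x n) (r n)" by metis
    obtain B where B: "\<And>n. norm (q n) \<le> B"
      using convergent_imp_Bseq[of q] q(2) by (auto simp: convergent_def Bseq_def)
    have r01: "r n \<in> {0..1}" for n using xr(1)[of n] by (simp add: G_def)
    have "(x n, r n) \<in> cball 0 (B + 1) \<times> {0..1}" for n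
    proof -
      have "norm (x n) \<le> norm (q n) + norm (x n - q n)" by (metis norm_triangle_sub)
      then show ?thesis using xr(2)[of n] r01[of n] B[of n] by (simp add: dist_norm)
    qed
    moreover have "compact (cball (0::'a) (B + 1) \<times> {0..1::real})"
      by (intro compact_Times compact_cball compact_Icc)
    note iffD1[OF compact_def this, rule_format, of "\<lambda>n. (x n, r n)"]
    ultimately obtain l' f where f: "strict_mono f" "((\<lambda>n. (x n, r n)) \<circ> f) \<longlonglongrightarrow> l'"
      by blast
    define y s where "y = fst l'" and "s = snd l'"
    have lim: "(\<lambda>n. x (f n)) \<longlonglongrightarrow> y" "(\<lambda>n. r (f n)) \<longlonglongrightarrow> s"
      using tendsto_fst[OF f(2)] tendsto_snd[OF f(2)] by (simp_all add: y_def s_def comp_def)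
    have ql: "(\<lambda>n. q (f n)) \<longlonglongrightarrow> l" using LIMSEQ_subseq_LIMSEQ[OF q(2) f(1)] by (simp add: comp_def)
    have s01: "0 \<le> s" "s \<le> 1"
      using LIMSEQ_le_const[OF lim(2)] LIMSEQ_le_const2[OF lim(2)] r01 by auto
    have "(y, s) \<in> G"
      unfolding G_def
    proof (clarify, intro conjI allI s01 subsetI)
      fix w assume w: "w \<in> cball y s"
      show "w \<in> W"
      proof (cases "s = 0")
        case True
        have "x (f n) \<in> W" for n
        proof -
          have "x (f n) \<in> cball (x (f n)) (r (f n))" using r01[of "f n"] by simp
          moreover have "cball (x (f n)) (r (f n)) \<subseteq> W" using xr(1)[of "f n"] by (simp add: G_def)
          ultimately show ?thesis by blast
        qed
        then have "y \<in> W" using closed_sequentially[OF W(1) _ lim(1)] by blast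
        then show ?thesis using w True by simp
      next
        case False
        then have spos: "0 < s" using s01 by simp
        \<comment> \<open>The point \<open>w\<close> is transported to the same relative position in
          the approximating balls; dividing by \<open>s\<close> is why radius 0 is treated
          separately.\<close>
        let ?w = "\<lambda>n. x (f n) + (r (f n) / s) *\<^sub>R (w - y)"
        have "?w n \<in> W" for n
        proof -
          have "norm (w - y) / s \<le> 1" using w spos by (simp add: dist_norm norm_minus_commute)
          then have "r (f n) * (norm (w - y) / s) \<le> r (f n) * 1"
            using r01[of "f n"] by (intro mult_left_mono) auto
          then have "?w n \<in> cball (x (f n)) (r (f n))"
            using r01[of "f n"] spos by (simp add: dist_norm)
          moreover have "cball (x (f n)) (r (f n)) \<subseteq> W" using xr(1)[of "f n"] by (simp add: G_def)
          ultimately show ?thesis by blast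
        qed
        moreover have "?w \<longlonglongrightarrow> y + (s / s) *\<^sub>R (w - y)"
          using spos by (intro tendsto_intros lim) auto
        then have "?w \<longlonglongrightarrow> w" using spos by simp
        ultimately show ?thesis by (rule closed_sequentially[OF W(1)])
      qed
    next
      fix k
      have "(\<lambda>n. a k * (real k - h (x (f n)))) \<longlonglongrightarrow> a k * (real k - h y)"
        unfolding h_def by (intro tendsto_intros lim)
      then show "a k * (real k - h y) \<le> s"
        using xr(1) by (intro LIMSEQ_le[OF _ lim(2)]) (auto simp: G_def)
    qed
    moreover have "dist y l \<le> s"
    proof (rule LIMSEQ_le[OF _ lim(2)])
      show "(\<lambda>n. dist (x (f n)) (q (f n))) \<longlonglongrightarrow> dist y l" by (intro tendsto_intros lim ql)
    qed (use xr(2) in auto)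
    ultimately show "l \<in> V" by (auto simp: V_def)
  qed
  have "cball z s0 \<subseteq> V"
  proof (rule G_V)
    have "a k * (real k - h z) \<le> s0" for k
    proof -
      have "a k * (real k - h z) \<le> a k * real (k + 2)"
        using a_pos[of k] hz by (intro mult_left_mono) auto
      also have "\<dots> \<le> s0" using a_le[of 0 k] \<rho>(2)[of 0] by simp
      finally show ?thesis .
    qed
    then show "(z, s0) \<in> G" using s0 by (auto simp: G_def)
  qed
  then have "ball z s0 \<subseteq> interior V"
    using ball_subset_cball[of z s0] by (intro interior_maximal) auto
  then have intV: "interior V \<noteq> {}" using s0(1) centre_in_ball by blast
  then have V0: "V \<noteq> {}" by auto
  have "C11_loc (frontier V)"
  proof (rule C11_loc_frontier_of_inner_balls[OF \<open>convex V\<close> \<open>closed V\<close> intV])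
    fix p assume "p \<in> frontier V"
    \<comment> \<open>A frontier point within 1 of \<open>p\<close> lies in a ball with centre at
      height at most \<open>h p + 2\<close>, so the constraint with index \<open>k\<close> makes its
      radius at least \<open>a k\<close>.\<close>
    obtain k where k: "h p + 3 \<le> real k" using real_arch_simple by blast
    have "\<exists>x. q \<in> cball x (a k) \<and> cball x (a k) \<subseteq> V" if q: "q \<in> frontier V \<inter> ball p 1" for q
    proof -
      have "q \<in> V" using q \<open>closed V\<close> frontier_subset_closed by blast
      then obtain x r where x: "(x, r) \<in> G" "q \<in> cball x r" by (auto simp: V_def)
      have "r \<le> 1" using x by (simp add: G_def)
      then have "h x \<le> h p + 2"
        using hlip[of x q] hlip[of q p] x(2) q by (auto simp: dist_commute)
      then have "a k * 1 \<le> a k * (real k - h x)" using a_pos[of k] k by (intro mult_left_mono) auto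
      also have "\<dots> \<le> r" using x(1) by (simp add: G_def)
      finally have "a k \<le> r" by simp
      then obtain x' where "q \<in> cball x' (a k)" "cball x' (a k) \<subseteq> cball x r"
        using cball_smaller_radius[OF x(2) a_pos] by blast
      then show ?thesis using G_V[OF x(1)] by blast
    qed
    then show "\<exists>s>0. \<exists>\<delta>>0. \<forall>q\<in>frontier V \<inter> ball p \<delta>. \<exists>x. q \<in> cball x s \<and> cball x s \<subseteq> V"
      using a_pos[of k] zero_less_one by blast
  qed
  moreover have "?H (sym_diff (frontier W) (frontier V)) < ennreal \<epsilon>"
  proof -
    have sub1: "frontier W - frontier V \<subseteq> (\<Union>k. frontier (Wk k) - inner_ball_points (\<rho> k) (Wk k))"
    proof
      fix p assume p: "p \<in> frontier W - frontier V"
      then have pW: "p \<in> W" using W(1) frontier_subset_closed by blast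
      define j where "j = nat \<lceil>h p\<rceil>"
      have j: "h p \<le> real j" "real j < h p + 1" using h0[OF pW] by (auto simp: j_def; linarith)+
      have "p \<in> frontier (Wk j)"
      proof -
        have "p \<in> Wk j" using pW j hz by (simp add: Wk_def M_def)
        moreover have "p \<notin> interior (Wk j)"
          using p interior_mono[of "Wk j" W] by (auto simp: Wk_def frontier_def)
        ultimately show ?thesis using closure_subset by (auto simp: frontier_def)
      qed
      moreover have "p \<notin> inner_ball_points (\<rho> j) (Wk j)"
      proof
        assume "p \<in> inner_ball_points (\<rho> j) (Wk j)"
        then obtain x where x: "p \<in> cball x (\<rho> j)" "cball x (\<rho> j) \<subseteq> W"
          by (auto simp: inner_ball_points_def Wk_def)
        have xW: "x \<in> W" using x(2) \<rho>(1)[of j] by (auto simp: subset_iff)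
        \<comment> \<open>The ceiling loses less than 1 and the radius is at most 1.\<close>
        have hx: "real j - 2 < h x"
          using hlip[of x p] x(1) \<rho>(2)[of j] s0(2) j by auto
        have "a k * (real k - h x) \<le> \<rho> j" for k
        proof (cases "j \<le> Suc k")
          case True
          have "a k * (real k - h x) \<le> a k * real (k + 2)"
            using a_pos[of k] h0[OF xW] by (intro mult_left_mono) auto
          then show ?thesis using a_le[OF True] by linarith
        next
          case False
          then have "real k - h x \<le> 0" using hx by auto
          then have "a k * (real k - h x) \<le> 0" using a_pos[of k] by (simp add: mult_le_0_iff)
          then show ?thesis using \<rho>(1)[of j] by linarith
        qed
        then have "(x, \<rho> j) \<in> G" using x(2) \<rho>(1)[of j] \<rho>(2)[of j] s0(2) by (simp add: G_def)
        then have "p \<in> V" using G_V x(1) by blast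
        \<comment> \<open>The touching ball belongs to \<open>G\<close>, so \<open>p\<close> lies in
          \<open>V\<close>. Off the frontier of \<open>V\<close> it would be interior to
          \<open>V\<close> and thus to \<open>W\<close>.\<close>
        then have "p \<in> interior V" using p closure_subset by (auto simp: frontier_def)
        then show False using p interior_mono[OF VW] by (auto simp: frontier_def)
      qed
      ultimately show "p \<in> (\<Union>k. frontier (Wk k) - inner_ball_points (\<rho> k) (Wk k))" by blast
    qed
    have H1: "?H (frontier W - frontier V) \<le> ennreal (\<epsilon> / 4)"
    proof -
      have "?H (frontier W - frontier V) \<le> (\<Sum>k. ?H (frontier (Wk k) - inner_ball_points (\<rho> k) (Wk k)))"
        using hausdorff_measure_mono[OF sub1] hausdorff_measure_UN order_trans by blast
      also have "\<dots> \<le> (\<Sum>k. ennreal (\<epsilon> / 4 * (1/2) ^ Suc k))"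
        using \<rho>(3) by (intro suminf_le) (auto simp: less_imp_le)
      also have "\<dots> = ennreal (\<epsilon> / 4)"
      proof -
        have "(\<lambda>k. \<epsilon> / 4 * (1/2) ^ Suc k) sums (\<epsilon> / 4 * 1)"
          by (intro sums_mult power_half_series)
        then show ?thesis using \<epsilon> by (intro suminf_ennreal_eq) auto
      qed
      finally show ?thesis .
    qed
    have sub2: "frontier V - frontier W \<subseteq> closest_point V ` (frontier W - frontier V)"
    proof
      fix y assume y: "y \<in> frontier V - frontier W"
      have yV: "y \<in> V" using y \<open>closed V\<close> frontier_subset_closed by blast
      \<comment> \<open>If the normal ray stayed in \<open>W\<close>, then \<open>u\<close> would be
        a recession direction along which the height does not decrease. Shifting a ball of
        \<open>G\<close> by \<open>u\<close> would keep it in \<open>G\<close>, giving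
        \<open>y + u \<in> V\<close> against the support inequality.\<close>
      have exit: "\<exists>s\<ge>0. y + s *\<^sub>R u \<notin> W"
        if u: "norm u = 1" "\<And>z. z \<in> V \<Longrightarrow> u \<bullet> (z - y) \<le> 0" for u
      proof (rule ccontr)
        assume "\<not> ?thesis"
        then have ray: "\<And>s. 0 \<le> s \<Longrightarrow> y + s *\<^sub>R u \<in> W" by blast
        have rec: "x + s *\<^sub>R u \<in> W" if "x \<in> W" "0 \<le> s" for x s
          using recession_direction_from_point[OF W(1,2) ray that] .
        \<comment> \<open>Otherwise \<open>h\<close> would become negative along the ray.\<close>
        have eu: "0 \<le> e \<bullet> u"
        proof (rule ccontr)
          assume neg: "\<not> 0 \<le> e \<bullet> u"
          have yW: "y \<in> W" using yV VW by blast
          define s where "s = (h y + 1) / (- (e \<bullet> u))"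
          have "0 \<le> s" unfolding s_def using neg h0[OF yW] by (intro divide_nonneg_pos) auto
          then have "0 \<le> h (y + s *\<^sub>R u)" using ray h0 by blast
          moreover have "h (y + s *\<^sub>R u) = h y + s * (e \<bullet> u)" by (simp add: h_def inner_add_right)
          moreover have "s * (e \<bullet> u) = - (h y + 1)" using neg by (simp add: s_def)
          ultimately show False by linarith
        qed
        obtain x r where x: "(x, r) \<in> G" "y \<in> cball x r" using yV by (auto simp: V_def)
        have "(x + u, r) \<in> G"
          unfolding G_def
        proof (clarify, intro conjI allI subsetI)
          fix w assume "w \<in> cball (x + u) r"
          then have "w - u \<in> cball x r" by (simp add: dist_norm algebra_simps)
          then have "w - u \<in> W" using x(1) by (auto simp: G_def)
          then show "w \<in> W" using rec[of "w - u" 1] by simp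
        next
          fix k
          have "a k * (real k - h (x + u)) \<le> a k * (real k - h x)"
            using a_pos[of k] eu by (intro mult_left_mono) (auto simp: h_def inner_add_right)
          also have "\<dots> \<le> r" using x(1) by (simp add: G_def)
          finally show "a k * (real k - h (x + u)) \<le> r" .
        qed (use x(1) in \<open>auto simp: G_def\<close>)
        moreover have "y + u \<in> cball (x + u) r" using x(2) by (simp add: dist_norm)
        ultimately have "y + u \<in> V" using G_V by blast
        then have "u \<bullet> u \<le> 0" using u(2) by fastforce
        then show False using u(1) by (simp add: dot_square_norm)
      qed
      obtain x where x: "x \<in> frontier W" "closest_point V x = y"
        using frontier_exit_point[OF \<open>convex V\<close> \<open>closed V\<close> intV _ W(1) VW exit] y by blast
      \<comment> \<open>The projection fixes points of \<open>V\<close>, so \<open>x\<close> would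
        coincide with \<open>y\<close>, which is not on the frontier of \<open>W\<close>.\<close>
      have "x \<notin> frontier V"
      proof
        assume "x \<in> frontier V"
        then have "x \<in> V" using \<open>closed V\<close> frontier_subset_closed by blast
        then have "y = x" using x(2) closest_point_self by metis
        then show False using x(1) y by blast
      qed
      then show "y \<in> closest_point V ` (frontier W - frontier V)" using x by blast
    qed
    have H2: "?H (frontier V - frontier W) \<le> ennreal (\<epsilon> / 4)"
    proof -
      have "?H (frontier V - frontier W) \<le> ?H (closest_point V ` (frontier W - frontier V))"
        by (rule hausdorff_measure_mono[OF sub2])
      also have "\<dots> \<le> ennreal (1 ^ (DIM('a) - 1)) * ?H (frontier W - frontier V)"
      proof (rule hausdorff_measure_lipschitz_image)
        show "dist (closest_point V x) (closest_point V y) \<le> 1 * dist x y" for x y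
          using closest_point_lipschitz[OF \<open>convex V\<close> \<open>closed V\<close>] V0 by simp
      qed simp
      finally show ?thesis using H1 by simp
    qed
    have "?H (sym_diff (frontier W) (frontier V)) \<le> ennreal (\<epsilon> / 4) + ennreal (\<epsilon> / 4)"
      using H1 H2 hausdorff_measure_Un add_mono order_trans by blast
    also have "\<dots> = ennreal (\<epsilon> / 2)" using \<epsilon> by (simp add: ennreal_plus[symmetric] del: ennreal_plus)
    also have "\<dots> < ennreal \<epsilon>" using \<epsilon> by (simp add: ennreal_lessI)
    finally show ?thesis .
  qed
  ultimately show ?thesis using that \<open>closed V\<close> \<open>convex V\<close> intV by blast
qed

section \<open>Cylinders\<close>

text \<open>Polarisation of the distances to the images of 0 and 1 gives
  \<open>g t \<bullet> g 1 = t\<close>, and then \<open>g t - t *\<^sub>R g 1\<close> has norm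
  0.\<close>

lemma isometric_real_line_affine:
  fixes \<gamma> :: "real \<Rightarrow> 'a::real_inner"
  assumes "\<And>s t. dist (\<gamma> s) (\<gamma> t) = dist s t"
  shows "\<gamma> t = \<gamma> 0 + t *\<^sub>R (\<gamma> 1 - \<gamma> 0)" and "norm (\<gamma> 1 - \<gamma> 0) = 1"
proof -
  define g where "g t = \<gamma> t - \<gamma> 0" for t
  have n: "norm (g t) = \<bar>t\<bar>" for t using assms[of t 0] by (simp add: g_def dist_norm)
  have d: "norm (g t - g 1) = \<bar>t - 1\<bar>" using assms[of t 1] by (simp add: g_def dist_norm)
  have "norm (g t - g 1) ^ 2 = norm (g t) ^ 2 - 2 * (g t \<bullet> g 1) + norm (g 1) ^ 2"
    unfolding power2_norm_eq_inner by (simp add: inner_diff inner_commute)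
  then have i: "g t \<bullet> g 1 = t" by (simp add: n d power2_eq_square algebra_simps)
  have "norm (g t - t *\<^sub>R g 1) ^ 2 = norm (g t) ^ 2 - 2 * t * (g t \<bullet> g 1) + t ^ 2 * norm (g 1) ^ 2"
    unfolding power2_norm_eq_inner
    by (simp add: inner_diff inner_commute power2_eq_square algebra_simps)
  also have "\<dots> = 0" by (simp add: n i power2_eq_square)
  finally show "\<gamma> t = \<gamma> 0 + t *\<^sub>R (\<gamma> 1 - \<gamma> 0)" by (simp add: g_def algebra_simps)
  show "norm (\<gamma> 1 - \<gamma> 0) = 1" using n[of 1] by (simp add: g_def)
qed

lemma frontier_translation_invariant:
  fixes W :: "'a::real_normed_vector set"
  assumes "\<And>x t. x \<in> W \<Longrightarrow> x + t *\<^sub>R v \<in> W" "x \<in> frontier W"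
  shows "x + t *\<^sub>R v \<in> frontier W"
proof -
  have "(+) (t *\<^sub>R v) ` W = W"
  proof
    show "(+) (t *\<^sub>R v) ` W \<subseteq> W" using assms(1) by (auto simp: add.commute)
    show "W \<subseteq> (+) (t *\<^sub>R v) ` W"
    proof
      fix y assume "y \<in> W"
      from assms(1)[OF this, of "- t"] have "y - t *\<^sub>R v \<in> W" by simp
      then show "y \<in> (+) (t *\<^sub>R v) ` W" by (intro image_eqI[of _ _ "y - t *\<^sub>R v"]) auto
    qed
  qed
  then have "frontier W = (+) (t *\<^sub>R v) ` frontier W" by (metis frontier_translation)
  then show ?thesis using assms(2) by (metis add.commute imageI)
qed

lemma hausdorff_measure_separated_family:
  assumes "\<And>i x y. i < n \<Longrightarrow> x \<in> (\<Union>j<i. Z j) \<Longrightarrow> y \<in> Z i \<Longrightarrow> 1 \<le> dist x y"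
    and "\<And>i. i < n \<Longrightarrow> c \<le> hausdorff_measure m (Z i)"
  shows "of_nat n * c \<le> hausdorff_measure m (\<Union>j<n. Z j)"
  using assms
proof (induction n)
  case (Suc n)
  have "of_nat (Suc n) * c = of_nat n * c + c" by (simp add: distrib_right add.commute)
  also have "\<dots> \<le> hausdorff_measure m (\<Union>j<n. Z j) + hausdorff_measure m (Z n)"
    using Suc.prems by (intro add_mono Suc.IH) (meson less_SucI lessI)+
  also have "\<dots> \<le> hausdorff_measure m ((\<Union>j<n. Z j) \<union> Z n)"
    using Suc.prems(1) by (intro hausdorff_measure_separated[of 1]) auto
  also have "(\<Union>j<n. Z j) \<union> Z n = (\<Union>j<Suc n. Z j)" by (auto simp: less_Suc_eq)
  finally show ?case .
qed simp

text \<open>The translates by multiples of \<open>4 v\<close> of a small piece of the surface have equal positive measure,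
  so only finitely many of them can be missed by \<open>T\<close>.\<close>

lemma finite_difference_meets_translates:
  fixes W :: "'a::euclidean_space set"
  assumes W: "closed W" "convex W" "interior W \<noteq> {}" and v: "norm v = 1"
    and inv: "\<And>x t. x \<in> frontier W \<Longrightarrow> x + t *\<^sub>R v \<in> frontier W"
    and fin: "hausdorff_measure (DIM('a) - 1) (frontier W - T) < top"
    and p: "p \<in> frontier W" and \<delta>: "0 < \<delta>" "\<delta> \<le> 1"
  shows "\<exists>j\<ge>N. \<exists>q\<in>T. dist q (p + (4 * real j) *\<^sub>R v) < \<delta>"
proof (rule ccontr)
  assume contr: "\<not> ?thesis"
  let ?H = "hausdorff_measure (DIM('a) - 1)"
  define Z where "Z i = frontier W \<inter> ball (p + (4 * real (N + i)) *\<^sub>R v) \<delta>" for i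
  define c where "c = ?H (frontier W \<inter> ball p \<delta>)"
  have c0: "0 < c" unfolding c_def by (rule hausdorff_measure_frontier_ball_pos[OF W(2,1,3) p \<delta>(1)])
  have cZ: "c \<le> ?H (Z i)" for i
  proof -
    let ?t = "4 * real (N + i)"
    have "frontier W \<inter> ball p \<delta> \<subseteq> (\<lambda>x. x - ?t *\<^sub>R v) ` Z i"
    proof
      fix x assume x: "x \<in> frontier W \<inter> ball p \<delta>"
      then have "x + ?t *\<^sub>R v \<in> Z i" using inv by (auto simp: Z_def)
      then show "x \<in> (\<lambda>x. x - ?t *\<^sub>R v) ` Z i" by (intro image_eqI[of _ _ "x + ?t *\<^sub>R v"]) auto
    qed
    then have "c \<le> ?H ((\<lambda>x. x - ?t *\<^sub>R v) ` Z i)" unfolding c_def by (rule hausdorff_measure_mono)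
    also have "\<dots> \<le> ennreal (1 ^ (DIM('a) - 1)) * ?H (Z i)"
      by (rule hausdorff_measure_lipschitz_image) (auto simp: dist_norm)
    finally show ?thesis by simp
  qed
  \<comment> \<open>The centres are at least 4 apart and the radii at most 1.\<close>
  have sep: "1 \<le> dist x y" if ij: "x \<in> (\<Union>j<i. Z j)" "y \<in> Z i" for i x y
  proof -
    obtain j where j: "j < i" "x \<in> Z j" using ij by blast
    define a b where "a = p + (4 * real (N + j)) *\<^sub>R v" and "b = p + (4 * real (N + i)) *\<^sub>R v"
    have "b - a = (4 * (real i - real j)) *\<^sub>R v" by (simp add: a_def b_def algebra_simps)
    then have "dist b a = 4 * (real i - real j)" using v j by (simp add: dist_norm)
    moreover have "4 \<le> 4 * (real i - real j)" using j by simp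
    moreover have "dist b a \<le> dist y b + dist x y + dist x a"
      by (smt (verit) dist_commute dist_triangle)
    moreover have "dist y b < \<delta>" "dist x a < \<delta>"
      using ij(2) j(2) by (auto simp: Z_def dist_commute a_def b_def)
    ultimately show ?thesis using \<delta> by linarith
  qed
  have sub: "(\<Union>j<n. Z j) \<subseteq> frontier W - T" for n
  proof clarify
    fix j x assume x: "x \<in> Z j"
    then have "x \<notin> T"
      using contr le_add1[of N j] by (force simp: Z_def dist_commute simp del: of_nat_add)
    then show "x \<in> frontier W - T" using x by (simp add: Z_def)
  qed
  have nc: "of_nat n * c \<le> ?H (frontier W - T)" for n
  proof -
    have "of_nat n * c \<le> ?H (\<Union>j<n. Z j)"
      by (rule hausdorff_measure_separated_family) (erule (1) sep, rule cZ)
    also have "\<dots> \<le> ?H (frontier W - T)" by (rule hausdorff_measure_mono[OF sub])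
    finally show ?thesis .
  qed
  define d where "d = enn2real (?H (frontier W - T))"
  have d: "?H (frontier W - T) = ennreal d" "0 \<le> d" using fin by (simp_all add: d_def)
  \<comment> \<open>The common lower bound \<open>c\<close> is finite and positive, so enough
    disjoint pieces exceed the finite measure \<open>d\<close>.\<close>
  have "c \<le> ennreal d" using nc[of 1] d by simp
  then have "c < top" by (rule le_less_trans) simp
  then obtain b where b: "c = ennreal b" "0 \<le> b" by (metis enn2real_nonneg ennreal_enn2real)
  have "0 < b" using c0 b by (simp add: ennreal_less_zero_iff)
  then obtain n where n: "d < real n * b" using reals_Archimedean3 by blast
  have "ennreal (real n * b) \<le> ennreal d"
    using nc[of n] d b by (simp add: ennreal_mult' ennreal_of_nat_eq_real_of_nat)
  then show False using n d by simp
qed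

text \<open>Combine \<open>x\<close> with the far point \<open>q N\<close> using weight
  \<open>s / (4 * j N)\<close>: the offset along \<open>v\<close> becomes exactly \<open>s\<close>,
  while the bounded deviation \<open>w N\<close> is scaled to 0.\<close>

lemma recession_direction_of_far_points:
  fixes V :: "'a::real_normed_vector set"
  assumes V: "closed V" "convex V"
    and far: "\<And>N. \<exists>j\<ge>N. \<exists>q\<in>V. dist q (p + (4 * real j) *\<^sub>R v) < \<delta>"
    and x: "x \<in> V" and s: "0 \<le> s"
  shows "x + s *\<^sub>R v \<in> V"
proof -
  obtain j q where jq: "\<And>N. N \<le> j N" "\<And>N. q N \<in> V" "\<And>N. dist (q N) (p + (4 * real (j N)) *\<^sub>R v) < \<delta>"
    using far by metis
  define t where "t N = s / (4 * real (j N))" for N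
  have lim0: "(\<lambda>N. s / (4 * real N)) \<longlonglongrightarrow> 0"
    using lim_const_over_n[of "s / 4"] by simp
  have t0: "t \<longlonglongrightarrow> 0"
  proof (rule tendsto_sandwich[OF _ _ tendsto_const lim0])
    show "\<forall>\<^sub>F N in sequentially. 0 \<le> t N" using s by (simp add: t_def)
    show "\<forall>\<^sub>F N in sequentially. t N \<le> s / (4 * real N)"
      using eventually_gt_at_top[of 0]
      by eventually_elim (use s jq(1) in \<open>auto simp: t_def intro!: divide_left_mono mult_pos_pos\<close>, use jq(1) less_le_trans in blast)
  qed
  define w where "w N = q N - (p + (4 * real (j N)) *\<^sub>R v)" for N
  have w: "norm (w N) < \<delta>" for N using jq(3)[of N] by (simp add: w_def dist_norm)
  have "(\<lambda>N. t N *\<^sub>R w N) \<longlonglongrightarrow> 0"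
    using t0 w
      by (intro Lim_null_comparison[OF _ tendsto_mult_left_zero[OF tendsto_rabs_zero[OF t0], of \<delta>]])
      (auto intro!: always_eventually mult_left_mono simp: less_imp_le)
  then have "(\<lambda>N. x + s *\<^sub>R v + t N *\<^sub>R (p - x) + t N *\<^sub>R w N) \<longlonglongrightarrow> x + s *\<^sub>R v + 0 *\<^sub>R (p - x) + 0"
    by (intro tendsto_intros t0)
  then have lim: "(\<lambda>N. x + s *\<^sub>R v + t N *\<^sub>R (p - x) + t N *\<^sub>R w N) \<longlonglongrightarrow> x + s *\<^sub>R v" by simp
  have "\<forall>\<^sub>F N in sequentially. t N < 1" using order_tendstoD(2)[OF t0] by simp
  then have "\<forall>\<^sub>F N in sequentially. x + s *\<^sub>R v + t N *\<^sub>R (p - x) + t N *\<^sub>R w N \<in> V"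
    using eventually_gt_at_top[of 0]
  proof eventually_elim
    case (elim N)
    have "0 < j N" using elim(2) jq(1)[of N] by linarith
    then have "t N * (4 * real (j N)) = s" by (simp add: t_def)
    then have "t N *\<^sub>R q N = t N *\<^sub>R w N + t N *\<^sub>R p + s *\<^sub>R v"
      by (simp add: w_def algebra_simps)
    then have "x + s *\<^sub>R v + t N *\<^sub>R (p - x) + t N *\<^sub>R w N = (1 - t N) *\<^sub>R x + t N *\<^sub>R q N"
      by (simp add: algebra_simps)
    moreover have "(1 - t N) *\<^sub>R x + t N *\<^sub>R q N \<in> V"
      using elim s jq(2) x by (intro convexD_alt[OF V(2)]) (auto simp: t_def)
    ultimately show ?case by simp
  qed
  then show ?thesis by (rule Lim_in_closed_set[OF V(1) _ _ lim]) simp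
qed

text \<open>The frontier of \<open>V\<close> comes close to arbitrarily far translates of
  \<open>p\<close> in both directions \<open>v\<close> and \<open>- v\<close>, so both are recession
  directions of \<open>V\<close>.\<close>

lemma finite_difference_from_cylinder:
  fixes W V :: "'a::euclidean_space set"
  assumes W: "closed W" "convex W" "interior W \<noteq> {}" and v: "norm v = 1"
    and inv: "\<And>x t. x \<in> W \<Longrightarrow> x + t *\<^sub>R v \<in> W"
    and V: "closed V" "convex V"
    and fin: "hausdorff_measure (DIM('a) - 1) (frontier W - frontier V) < top"
    and p: "p \<in> frontier W"
  shows "p \<in> frontier V" and "x \<in> V \<Longrightarrow> x + t *\<^sub>R v \<in> V"
proof -
  have meets: "\<exists>j\<ge>N. \<exists>q\<in>frontier V. dist q (p + (4 * real j) *\<^sub>R u) < \<delta>"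
    if "0 < \<delta>" "\<delta> \<le> 1" "u = v \<or> u = - v" for N \<delta> u
  proof (rule finite_difference_meets_translates[OF W _ _ fin p that(1,2)])
    show "norm u = 1" using that(3) v by auto
    show "x + t *\<^sub>R u \<in> frontier W" if "x \<in> frontier W" for x t
      using frontier_translation_invariant[OF inv that, of t] frontier_translation_invariant[OF inv that, of "- t"]
        \<open>u = v \<or> u = - v\<close> by auto
  qed
  have fV: "frontier V \<subseteq> V" using V(1) by (rule frontier_subset_closed)
  have rec: "x + s *\<^sub>R u \<in> V" if "u = v \<or> u = - v" "x \<in> V" "0 \<le> s" for x s u
    by (rule recession_direction_of_far_points[OF V _ that(2,3), of p u 1])
      (use meets[of 1 u] that(1) fV in \<open>meson subsetD order_refl zero_less_one\<close>)
  have invV: "x + t *\<^sub>R v \<in> V" if "x \<in> V" for x t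
    using rec[of v x t] rec[of "- v" x "- t"] that by (cases "0 \<le> t") auto
  then show "x \<in> V \<Longrightarrow> x + t *\<^sub>R v \<in> V" .
  \<comment> \<open>A frontier point of \<open>V\<close> near some translate of \<open>p\<close> is
    shifted back to \<open>p\<close> by the invariance of \<open>V\<close> just obtained.\<close>
  have "\<exists>y\<in>frontier V. dist y p < e" if e: "0 < e" for e
  proof -
    obtain j q where q: "q \<in> frontier V" "dist q (p + (4 * real j) *\<^sub>R v) < min e 1"
      using meets[of "min e 1" v 0] e by auto
    let ?q = "q + (- (4 * real j)) *\<^sub>R v"
    have "?q \<in> frontier V" by (rule frontier_translation_invariant[OF invV q(1)])
    moreover have "dist ?q p < e" using q(2) by (simp add: dist_norm algebra_simps)
    ultimately show ?thesis by blast
  qed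
  then have "p \<in> closure (frontier V)" unfolding closure_approachable by blast
  then show "p \<in> frontier V" by (simp only: closure_closed[OF frontier_closed])
qed


section \<open>Both implications of the equivalence for a convex hypersurface\<close>

theorem theorem1p6:
  fixes S :: "(real ^ 'n) set"
  assumes "convex_hypersurface S"
    and "\<not> C11_loc S"
  shows "(\<forall>\<epsilon>::real. \<epsilon> > 0 \<longrightarrow>
            (\<exists>T :: (real ^ 'n) set. convex_hypersurface T \<and> C11_loc T \<and>
               hausdorff_measure (CARD('n) - 1) (sym_diff S T) < ennreal \<epsilon>))
         \<longleftrightarrow> \<not> (\<exists>L. is_line L \<and> L \<subseteq> S)"
proof -
  obtain W where W: "closed W" "convex W" "interior W \<noteq> {}" and S: "S = frontier W"
    using assms(1) by (auto simp: convex_hypersurface_def)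
  \<comment> \<open>A single line in \<open>W\<close> makes both of its directions recession
    directions at every point.\<close>
  have inv: "x + t *\<^sub>R v \<in> W" if "\<And>t. a + t *\<^sub>R v \<in> W" "x \<in> W" for a v x t
  proof (cases "0 \<le> t")
    case True
    then show ?thesis using recession_direction_from_point[OF W(1,2) _ that(2)] that(1) by blast
  next
    case False
    have "a + s *\<^sub>R (- v) \<in> W" for s using that(1)[of "- s"] by simp
    then have "x + (- t) *\<^sub>R (- v) \<in> W"
      using False by (intro recession_direction_from_point[OF W(1,2) _ that(2)]) auto
    then show ?thesis by simp
  qed
  show ?thesis
  proof (intro iffI notI)
    assume approx: "\<forall>\<epsilon>::real. \<epsilon> > 0 \<longrightarrow>
            (\<exists>T :: (real ^ 'n) set. convex_hypersurface T \<and> C11_loc T \<and>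
               hausdorff_measure (CARD('n) - 1) (sym_diff S T) < ennreal \<epsilon>)"
      and "\<exists>L. is_line L \<and> L \<subseteq> S"
    then obtain \<gamma> :: "real \<Rightarrow> real ^ 'n" where "\<forall>s t. dist (\<gamma> s) (\<gamma> t) = dist s t" "range \<gamma> \<subseteq> S"
      unfolding is_line_def by blast
    then have \<gamma>: "\<And>s t. dist (\<gamma> s) (\<gamma> t) = dist s t" "range \<gamma> \<subseteq> S" by blast+
    define v where "v = \<gamma> 1 - \<gamma> 0"
    have v: "norm v = 1" unfolding v_def by (rule isometric_real_line_affine(2)[OF \<gamma>(1)])
    have "\<gamma> 0 + t *\<^sub>R v \<in> W" for t
    proof -
      have "\<gamma> t \<in> W" using \<gamma>(2) frontier_subset_closed[OF W(1)] S by blast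
      then show ?thesis unfolding v_def isometric_real_line_affine(1)[OF \<gamma>(1), of t, symmetric] .
    qed
    then have invW: "x + t *\<^sub>R v \<in> W" if "x \<in> W" for x t using inv that by blast
    \<comment> \<open>Any finite bound on the difference contradicts the presence of a line; 1 is
      used.\<close>
    obtain T where T: "convex_hypersurface T" "C11_loc T"
      "hausdorff_measure (CARD('n) - 1) (sym_diff S T) < ennreal 1"
      using approx zero_less_one by blast
    obtain V where V: "closed V" "convex V" "interior V \<noteq> {}" "T = frontier V"
      using T(1) by (auto simp: convex_hypersurface_def)
    have fin: "hausdorff_measure (DIM(real ^ 'n) - 1) A < top" if "A \<subseteq> sym_diff S T" for A
    proof -
      have "hausdorff_measure (CARD('n) - 1) A < ennreal 1"
        using hausdorff_measure_mono[OF that] T(3) by (rule le_less_trans)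
      then have "hausdorff_measure (CARD('n) - 1) A < top" by (rule less_trans) simp
      then show ?thesis by simp
    qed
    have fin1: "hausdorff_measure (DIM(real ^ 'n) - 1) (frontier W - frontier V) < top"
      and fin2: "hausdorff_measure (DIM(real ^ 'n) - 1) (frontier V - frontier W) < top"
      using fin S V(4) by auto
    have "S \<subseteq> T"
      using finite_difference_from_cylinder(1)[OF W v invW V(1,2) fin1] S V(4) by blast
    moreover have "T \<subseteq> S"
    proof -
      obtain p where "p \<in> frontier W" using \<gamma>(2) S by blast
      then have invV: "x + t *\<^sub>R v \<in> V" if "x \<in> V" for x t
        using finite_difference_from_cylinder(2)[OF W v invW V(1,2) fin1] that by blast
      \<comment> \<open>Now that \<open>V\<close> is known to be invariant along \<open>v\<close>,
        the roles of \<open>W\<close> and \<open>V\<close> are exchanged.\<close>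
      show ?thesis
        using finite_difference_from_cylinder(1)[OF V(1-3) v invV W(1,2) fin2] S V(4) by blast
    qed
    ultimately show False using T(2) assms(2) by simp
  next
    assume no_line: "\<not> (\<exists>L. is_line L \<and> L \<subseteq> S)"
    \<comment> \<open>The empty set satisfies \<open>C11_loc\<close> vacuously. The point of
      \<open>S\<close> obtained here is the one through which a line is drawn below.\<close>
    have "S \<noteq> {}" using assms(2) by (auto simp: C11_loc_def)
    then obtain p where p: "p \<in> frontier W" using S by blast
    have nl: "\<exists>s. x + s *\<^sub>R v \<notin> W" if v: "v \<noteq> 0" and x: "x \<in> W" for v x
    proof (rule ccontr)
      assume "\<not> ?thesis"
      then have invW: "y + t *\<^sub>R v \<in> W" if "y \<in> W" for y t using inv that by blast
      \<comment> \<open>The assumed line lies only in \<open>W\<close>; invariance allows moving it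
        to the frontier point \<open>p\<close>, where it stays in \<open>S\<close>. Dividing by the
        norm makes the parametrisation isometric.\<close>
      define \<gamma> where "\<gamma> t = p + (t / norm v) *\<^sub>R v" for t
      have "dist (\<gamma> s) (\<gamma> t) = dist s t" for s t
        using v by (simp add: \<gamma>_def dist_norm flip: scaleR_diff_left diff_divide_distrib)
      moreover have "range \<gamma> \<subseteq> S"
        using frontier_translation_invariant[OF invW p] by (auto simp: \<gamma>_def S)
      ultimately show False using no_line unfolding is_line_def by blast
    qed
    show "\<forall>\<epsilon>::real. \<epsilon> > 0 \<longrightarrow>
            (\<exists>T :: (real ^ 'n) set. convex_hypersurface T \<and> C11_loc T \<and>
               hausdorff_measure (CARD('n) - 1) (sym_diff S T) < ennreal \<epsilon>)"
    proof (intro allI impI)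
      fix \<epsilon> :: real assume "0 < \<epsilon>"
      then obtain V where V: "closed V" "convex V" "interior V \<noteq> {}" "C11_loc (frontier V)"
        "hausdorff_measure (DIM(real ^ 'n) - 1) (sym_diff (frontier W) (frontier V)) < ennreal \<epsilon>"
        using C11_approximation_from_inside[OF W nl] by blast
      then show "\<exists>T :: (real ^ 'n) set. convex_hypersurface T \<and> C11_loc T \<and>
               hausdorff_measure (CARD('n) - 1) (sym_diff S T) < ennreal \<epsilon>"
        by (intro exI[of _ "frontier V"]) (auto simp: convex_hypersurface_def S)
    qed
  qed
qed

end
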